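(* Let $m \geq 2$ and $n\geq 3$, and let $k_0, k_1, \ldots, k_m$ and $l_0, l_1, \ldots, l_n$ be generic lines in the projective plane $\mathbb{P}^2$. Consider the $m\times n$ grid of quadrilaterals $Q_{i,j} := \Box (k_{i-1}, l_{j-1}, k_i, l_j)$, $1\le i\le m$, $1\le j\le n$. Let $r_{i,j}$ be the intersection point of the diagonals of $Q_{i,j}$. Then the following are equivalent. (i) The lines $k_0, k_1, \ldots, k_m, l_0, l_1, \ldots, l_n$ are tangent to a non-degenerate conic. (ii) The $m \times n$ grid of quadrilaterals admits an instance of touching inscribed conics $\mathcal{C}_{i,j}$ such that for every $i\in\{1,\dots,m\}$ the points $\{K_{i-1,i}l_j\}_{j= 0, \ldots, n}$ are collinear and for every $j\in\{1,\dots,n\}$ the points $\{k_{i}L_{j-1,j}\}_{i= 0, \ldots, m}$ are collinear, where $K_{i-1,i}l_{j-1}$, $K_{i-1,i}l_j$, $k_{i-1}L_{j-1,j}$, $k_iL_{j-1,j}$ denote the tangency points of the conic $\mathcal{C}_{i,j}$ inscribed in $Q_{i,j}$ on the edge-lines $l_{j-1}, l_j, k_{i-1}, k_i$, respectively. (iii) The $m\times n$ grid of quadrilaterals admits an instance of touching inscribed conics. (iv) The $m\times n$ grid of quadrilaterals admits a $1$-parameter family of touching inscribed conics. (v) For every $j\in\{1,\dots,n\}$ the points $\{r_{i,j}\}_{i=1, \ldots, m}$ are collinear, and for every $i\in\{1,\dots,m\}$ the points $\{r_{i,j}\}_{j=1, \ldots, n}$ are collinear. (vi) For every $i\in\{1,\dots,m\}$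 the points $\{r_{i,j}\}_{j=1, \ldots, n}$ are collinear.
   Context: The projective plane is real. Lines are called generic if they are pairwise distinct and no three of them are concurrent. $(a,b)$ denotes the line through points $a,b$. For lines $k,l,k',l'$ that are generic, $\Box(k,l,k',l')$ denotes the quadrilateral with consecutive vertices $k\cap l,\ k\cap l',\ k'\cap l',\ k'\cap l$; its edge-lines are $k,l',k',l$, and its diagonals are $(k\cap l, k'\cap l')$ and $(k\cap l', k'\cap l)$. Inscribed conics: a non-degenerate inscribed conic of a quadrilateral is a non-degenerate conic tangent to the four edge-lines at points (the tangency points) distinct from the vertices. In addition, exactly one degenerate conic counts as an inscribed conic: the double line supported on the line joining the two intersection points of opposite edge-lines ($k\cap k'$ and $l\cap l'$); its tangency points are its intersection points with the edge-lines. Two quadrilaterals of the grid are neighbouring if they share an edge ($Q_{i,j}$ and $Q_{i+1,j}$ share the edge on $k_i$; $Q_{i,j}$ and $Q_{i,j+1}$ share the edge on $l_j$). An instance of touching inscribed conics is a choice of an inscribed conic $\mathcal{C}_{i,j}$ in each $Q_{i,j}$ such that for any two neighbouring quadrilaterals the two inscribed conics have the same tangency point on their common edge-line; consequently the labels $K_{i-1,i}l_j$ (tangency point on $l_j$ of the conics in the strip $\{Q_{i,j}\}_{j=1,\dots,n}$ adjacent to $l_j$) and $k_iL_{j-1,j}$ (tangency point on $k_i$ of the conics in the strip $\{Q_{i,j}\}_{i=1,\dots,m}$ adjacent to $k_i$) are well defined. The grid admits a $1$-parameter family of touching inscribed conics if, for every edge of the grid and every point $p$ on the corresponding edge-line different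 from the two endpoints of the edge, there is exactly one instance of touching inscribed conics with tangency point $p$ on that edge. *)

theory Defs
  imports "HOL-Analysis.Analysis"
begin

section \<open>The real projective plane\<close>

text \<open>Points and lines are the one- and two-dimensional linear subspaces of
  three-dimensional real space.\<close>

typedef proj_point = "{S :: (real^3) set. subspace S \<and> dim S = 1}"
  morphisms point_space Abs_proj_point
  using choose_subspace_of_subspace[of 1 "UNIV :: (real^3) set"] by auto

typedef proj_line = "{S :: (real^3) set. subspace S \<and> dim S = 2}"
  morphisms line_space Abs_proj_line
  using choose_subspace_of_subspace[of 2 "UNIV :: (real^3) set"] by auto

definition on_line :: "proj_point \<Rightarrow> proj_line \<Rightarrow> bool" where
  "on_line p a \<longleftrightarrow> point_space p \<subseteq> line_space a"

text \<open>\<open>meet\<close> and \<open>join\<close> are meaningful only for distinct arguments.\<close>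

definition meet :: "proj_line \<Rightarrow> proj_line \<Rightarrow> proj_point" where
  "meet a b = (THE p. on_line p a \<and> on_line p b)"

definition join :: "proj_point \<Rightarrow> proj_point \<Rightarrow> proj_line" where
  "join p q = (THE a. on_line p a \<and> on_line q a)"

definition proj_collinear :: "proj_point set \<Rightarrow> bool" where
  "proj_collinear S \<longleftrightarrow> (\<exists>a. \<forall>p\<in>S. on_line p a)"

definition generic_lines :: "proj_line list \<Rightarrow> bool" where
  "generic_lines as \<longleftrightarrow> distinct as \<and>
    (\<forall>a\<in>set as. \<forall>b\<in>set as. \<forall>c\<in>set as. a \<noteq> b \<and> b \<noteq> c \<and> a \<noteq> c \<longrightarrow>
      \<not> (\<exists>p. on_line p a \<and> on_line p b \<and> on_line p c))"


section \<open>Conics\<close>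

text \<open>A conic, degenerate or not, is a nonzero symmetric matrix up to a nonzero scalar factor,
  represented by the line that the matrix spans.\<close>

typedef conic = "{S :: (real^3^3) set. \<exists>A. transpose A = A \<and> A \<noteq> 0 \<and> S = span {A}}"
  morphisms conic_space Abs_conic
proof -
  have "mat 1 \<noteq> (0 :: real^3^3)" by (simp add: mat_def vec_eq_iff)
  then show ?thesis using transpose_mat by blast
qed

definition nondegenerate :: "conic \<Rightarrow> bool" where
  "nondegenerate C \<longleftrightarrow> (\<exists>A\<in>conic_space C. det A \<noteq> 0)"

definition on_conic :: "proj_point \<Rightarrow> conic \<Rightarrow> bool" where
  "on_conic p C \<longleftrightarrow> (\<forall>A\<in>conic_space C. \<forall>v\<in>point_space p. v \<bullet> (A *v v) = 0)"

text \<open>The gradient of \<open>\<lambda>v. v \<bullet> (A *v v)\<close> at \<open>v\<close> is \<open>2 *\<^sub>R (A *v v)\<close>. On a non-degenerate conic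
  it does not vanish, and its orthogonal complement is the tangent line at \<open>v\<close>.\<close>

definition tangent_at :: "conic \<Rightarrow> proj_line \<Rightarrow> proj_point \<Rightarrow> bool" where
  "tangent_at C a p \<longleftrightarrow> on_line p a \<and> on_conic p C \<and>
    (\<forall>A\<in>conic_space C. \<forall>v\<in>point_space p. \<forall>w\<in>line_space a. w \<bullet> (A *v v) = 0)"

definition tangent :: "conic \<Rightarrow> proj_line \<Rightarrow> bool" where
  "tangent C a \<longleftrightarrow> (\<exists>p. tangent_at C a p)"

text \<open>The double line supported on \<open>d \<bullet> v = 0\<close> is \<open>(d \<bullet> v)\<^sup>2 = 0\<close>.\<close>

definition is_double_line :: "conic \<Rightarrow> proj_line \<Rightarrow> bool" where
  "is_double_line C a \<longleftrightarrow>
    (\<exists>d. line_space a = {v. d \<bullet> v = 0} \<and> conic_space C = span {\<chi> i j. d $ i * d $ j})"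


section \<open>Quadrilaterals and inscribed conics\<close>

text \<open>\<open>Quad a b a' b'\<close> has the consecutive vertices listed by \<open>vertices\<close>; \<open>a, a'\<close> and
  \<open>b, b'\<close> are the pairs of opposite edge-lines.\<close>

datatype quad = Quad proj_line proj_line proj_line proj_line

fun vertices :: "quad \<Rightarrow> proj_point set" where
  "vertices (Quad a b a' b') = {meet a b, meet a b', meet a' b', meet a' b}"

fun edge_lines :: "quad \<Rightarrow> proj_line set" where
  "edge_lines (Quad a b a' b') = {a, b', a', b}"

fun diagonals_meet :: "quad \<Rightarrow> proj_point" where
  "diagonals_meet (Quad a b a' b') =
    meet (join (meet a b) (meet a' b')) (join (meet a b') (meet a' b))"

fun opposite_edges_line :: "quad \<Rightarrow> proj_line" where
  "opposite_edges_line (Quad a b a' b') = join (meet a a') (meet b b')"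

definition inscribed :: "conic \<Rightarrow> quad \<Rightarrow> bool" where
  "inscribed C Q \<longleftrightarrow>
    (nondegenerate C \<and> (\<forall>e\<in>edge_lines Q. \<exists>p. tangent_at C e p \<and> p \<notin> vertices Q)) \<or>
    is_double_line C (opposite_edges_line Q)"

text \<open>For an inscribed conic and an edge-line the common point exists and is unique: it is the
  point of contact if the conic is non-degenerate, and the intersection of the supporting line
  with the edge-line if the conic is a double line.\<close>

definition tangency_point :: "conic \<Rightarrow> proj_line \<Rightarrow> proj_point" where
  "tangency_point C e = (THE p. on_line p e \<and> on_conic p C)"


section \<open>Grids of quadrilaterals\<close>

text \<open>Used only for \<open>i, j \<ge> 1\<close>.\<close>

definition grid_quad :: "(nat \<Rightarrow> proj_line) \<Rightarrow> (nat \<Rightarrow> proj_line) \<Rightarrow> nat \<Rightarrow> nat \<Rightarrow> quad" where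
  "grid_quad k l i j = Quad (k (i - 1)) (l (j - 1)) (k i) (l j)"

text \<open>Extensionality fixes the values of \<open>C\<close> outside the index set, so that an instance is
  determined by its conics.\<close>

definition touching_instance ::
  "nat \<Rightarrow> nat \<Rightarrow> (nat \<Rightarrow> proj_line) \<Rightarrow> (nat \<Rightarrow> proj_line) \<Rightarrow> (nat \<times> nat \<Rightarrow> conic) \<Rightarrow> bool" where
  "touching_instance m n k l C \<longleftrightarrow>
    C \<in> extensional ({1..m} \<times> {1..n}) \<and>
    (\<forall>i\<in>{1..m}. \<forall>j\<in>{1..n}. inscribed (C (i, j)) (grid_quad k l i j)) \<and>
    (\<forall>i\<in>{1..<m}. \<forall>j\<in>{1..n}.
      tangency_point (C (i, j)) (k i) = tangency_point (C (i + 1, j)) (k i)) \<and>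
    (\<forall>i\<in>{1..m}. \<forall>j\<in>{1..<n}.
      tangency_point (C (i, j)) (l j) = tangency_point (C (i, j + 1)) (l j))"

definition collinear_tangency_points ::
  "nat \<Rightarrow> nat \<Rightarrow> (nat \<Rightarrow> proj_line) \<Rightarrow> (nat \<Rightarrow> proj_line) \<Rightarrow> (nat \<times> nat \<Rightarrow> conic) \<Rightarrow> bool" where
  "collinear_tangency_points m n k l C \<longleftrightarrow>
    (\<forall>i\<in>{1..m}. proj_collinear
      (\<Union>j\<in>{1..n}. {tangency_point (C (i, j)) (l (j - 1)), tangency_point (C (i, j)) (l j)})) \<and>
    (\<forall>j\<in>{1..n}. proj_collinear
      (\<Union>i\<in>{1..m}. {tangency_point (C (i, j)) (k (i - 1)), tangency_point (C (i, j)) (k i)}))"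

text \<open>Every edge of the grid is an edge of some \<open>grid_quad k l i j\<close>; the endpoints of the edge
  on the edge-line \<open>e\<close> are exactly the vertices of that quadrilateral lying on \<open>e\<close>.\<close>

definition one_parameter_family ::
  "nat \<Rightarrow> nat \<Rightarrow> (nat \<Rightarrow> proj_line) \<Rightarrow> (nat \<Rightarrow> proj_line) \<Rightarrow> bool" where
  "one_parameter_family m n k l \<longleftrightarrow>
    (\<forall>i\<in>{1..m}. \<forall>j\<in>{1..n}. \<forall>e\<in>edge_lines (grid_quad k l i j). \<forall>p.
      on_line p e \<and> p \<notin> vertices (grid_quad k l i j) \<longrightarrow>
      (\<exists>!C. touching_instance m n k l C \<and> tangency_point (C (i, j)) e = p))"

definition common_tangent_conic ::
  "nat \<Rightarrow> nat \<Rightarrow> (nat \<Rightarrow> proj_line) \<Rightarrow> (nat \<Rightarrow> proj_line) \<Rightarrow> bool" where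
  "common_tangent_conic m n k l \<longleftrightarrow>
    (\<exists>C. nondegenerate C \<and> (\<forall>i\<in>{0..m}. tangent C (k i)) \<and> (\<forall>j\<in>{0..n}. tangent C (l j)))"

definition collinear_row_diagonals ::
  "nat \<Rightarrow> nat \<Rightarrow> (nat \<Rightarrow> proj_line) \<Rightarrow> (nat \<Rightarrow> proj_line) \<Rightarrow> bool" where
  "collinear_row_diagonals m n k l \<longleftrightarrow>
    (\<forall>i\<in>{1..m}. proj_collinear ((\<lambda>j. diagonals_meet (grid_quad k l i j)) ` {1..n}))"

definition collinear_column_diagonals ::
  "nat \<Rightarrow> nat \<Rightarrow> (nat \<Rightarrow> proj_line) \<Rightarrow> (nat \<Rightarrow> proj_line) \<Rightarrow> bool" where
  "collinear_column_diagonals m n k l \<longleftrightarrow>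
    (\<forall>j\<in>{1..n}. proj_collinear ((\<lambda>i. diagonals_meet (grid_quad k l i j)) ` {1..m}))"

end

theory Submission
  imports Defs
begin

text \<open>
  Everything is computed with normal vectors of lines, that is, in the dual plane. A symmetric
  matrix \<open>B\<close> is read as a quadratic form on normal vectors, and its zeros are the lines touching the
  conic whose matrix is the cofactor matrix of \<open>B\<close>; the point of contact on a touching line \<open>e\<close> is
  \<open>B *v e\<close>. Being tangent to given lines thus becomes a linear condition on \<open>B\<close>.

  The forms \<open>B\<close> that vanish on the four edge-lines of a quadrilateral are a pencil. Its degenerate
  members are three pairs of points: the two pairs of opposite vertices, and the intersection points
  of opposite edge-lines, whose cofactor matrix is the double line that counts as inscribed. So the
  inscribed conics correspond to the parameters \<open>c \<noteq> 0\<close> of the pencil (\<open>inscribed_iff\<close>), and the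
  point of contact with an edge-line runs linearly in \<open>c\<close> over the line without the two vertices.

  Inscribed conics with parameters \<open>c, c'\<close> on the two sides of an edge touch iff \<open>c * c'\<close> is a
  certain nonzero number given by the lines (\<open>touching_iff\<close>). Hence instances are the solutions of a
  multiplicative system on the grid. From one solution all others arise by multiplying with \<open>x\<close> and
  with \<open>1 / x\<close> on the two colours of the chessboard, so one instance is as good as a one-parameter
  family (\<open>one_parameter_family_iff\<close>). The four equations around an inner vertex of the grid are
  compatible iff two cross ratios agree, and this says that the six lines around that vertex touch
  one conic (\<open>six_lines\<close>, \<open>solution_six_lines\<close>). Neighbouring vertices share five of the six lines
  and five generic lines have only one tangent conic (\<open>vanishing_transfer\<close>), so an instance gives a
  conic touching all lines.

  Conversely, let \<open>D\<close> be the form of a conic touching all lines. It belongs to all the pencils. For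
  every quadrilateral take the member of its pencil whose chords of contact are the polars, with
  respect to \<open>D\<close>, of the two intersection points of opposite edge-lines (\<open>contact_dual\<close>). The polar
  of \<open>k (i - 1) \<inter> k i\<close> is then the chord for the whole \<open>i\<close>-th strip, and so on: these conics touch
  and their points of contact are collinear. The same polars carry the diagonal points, because a
  diagonal point is the pole of one and the same line for all members of the pencil, \<open>D\<close> included
  (\<open>diagonal_point_polar\<close>).

  Finally, if the diagonal points along two lines \<open>a, a'\<close> lie on a line, this line determines a form
  vanishing on \<open>a\<close>, \<open>a'\<close> and all lines crossing them (\<open>strip_conic\<close>). In affine coordinates of the
  dual plane in which \<open>a\<close> and \<open>a'\<close> are the directions of the axes, the crossing lines are points
  \<open>P\<^sub>0, P\<^sub>1, \<dots>\<close>, and a diagonal point becomes the second diagonal of the rectangle with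
  opposite corners \<open>P\<^sub>j\<^sub>-\<^sub>1, P\<^sub>j\<close>. That all these diagonals pass through one point means that the
      \<open>P\<^sub>j\<close> lie on a
  hyperbola with that point as centre and asymptotes parallel to the axes. The conics found for
  neighbouring rows share five tangent lines, hence agree.
\<close>

unbundle cross3_syntax

section \<open>Brackets, cofactors and isotropic vectors\<close>

text \<open>The determinant of the three vectors. It vanishes iff the lines with these normal vectors
  are concurrent.\<close>

definition bracket :: "real^3 \<Rightarrow> real^3 \<Rightarrow> real^3 \<Rightarrow> real" where
  "bracket x y z = x \<bullet> (y \<times> z)"

lemma bracket_rotate: "bracket y z x = bracket x y z" "bracket z x y = bracket x y z"
  by (simp_all add: bracket_def cross3_simps)

lemma bracket_swap: "bracket y x z = - bracket x y z" "bracket x z y = - bracket x y z"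
  by (simp_all add: bracket_def cross3_simps)

lemma bracket_repeated [simp]: "bracket x x y = 0" "bracket x y x = 0" "bracket y x x = 0"
  by (simp_all add: bracket_def cross3_simps)

lemma cross_inner_eq_bracket: "(x \<times> y) \<bullet> z = bracket x y z" "z \<bullet> (x \<times> y) = bracket x y z"
  by (simp_all add: bracket_def cross3_simps)

lemma bracket_nonzero_cross:
  assumes "bracket x y z \<noteq> 0"
  shows "x \<times> y \<noteq> 0 \<and> y \<times> z \<noteq> 0 \<and> x \<times> z \<noteq> 0 \<and> y \<times> x \<noteq> 0 \<and> z \<times> y \<noteq> 0 \<and> z \<times> x \<noteq> 0"
proof -
  have "bracket x y z = (x \<times> y) \<bullet> z" "bracket x y z = x \<bullet> (y \<times> z)" "bracket x y z = - y \<bullet> (x \<times> z)"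
    "bracket x y z = - (y \<times> x) \<bullet> z" "bracket x y z = - x \<bullet> (z \<times> y)" "bracket x y z = y \<bullet> (z \<times> x)"
    by (simp_all add: bracket_def cross3_simps)
  then show ?thesis
    using assms by (auto simp del: inner_minus_left)
qed

lemma cross_cross_bracket: "(w \<times> x) \<times> (y \<times> z) = bracket w x z *\<^sub>R y - bracket w x y *\<^sub>R z"
  by (simp add: cross_cross_det dot_cross_det bracket_def)

text \<open>Expansion of a vector in the reciprocal basis (Cramer).\<close>

lemma bracket_cramer:
  "bracket x y z *\<^sub>R v = (v \<bullet> x) *\<^sub>R (y \<times> z) + (v \<bullet> y) *\<^sub>R (z \<times> x) + (v \<bullet> z) *\<^sub>R (x \<times> y)"
  by (simp add: bracket_def cross3_simps forall_3)

lemma orthogonal_to_basis_eq_0: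
  assumes "bracket x y z \<noteq> 0" "v \<bullet> x = 0" "v \<bullet> y = 0" "v \<bullet> z = 0"
  shows "v = 0"
  using bracket_cramer[of x y z v] assms by simp

lemma parallel_cross:
  assumes "p \<times> q \<noteq> 0" "u \<bullet> p = 0" "u \<bullet> q = 0"
  obtains c where "u = c *\<^sub>R (p \<times> q)"
proof -
  have "u \<times> (p \<times> q) = 0"
    using assms by (simp add: Lagrange)
  then have "collinear {0, p \<times> q, u}"
    by (metis cross_eq_0 cross_skew neg_0_equal_iff_equal)
  then show thesis
    using assms(1) that by (auto simp: collinear_lemma)
qed

lemma parallelE:
  fixes u v :: "real^3"
  assumes "u \<times> v = 0" "v \<noteq> 0"
  obtains c where "u = c *\<^sub>R v"
proof -
  have "collinear {0, v, u}"
    using assms by (metis cross_eq_0 cross_skew neg_0_equal_iff_equal)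
  then show thesis
    using assms(2) that by (auto simp: collinear_lemma)
qed

text \<open>The three-term Grassmann-Pluecker relation: modulo \<open>p\<close>, brackets with \<open>p\<close> are determinants
  in a plane.\<close>

lemma bracket_pluecker:
  "bracket p x y * bracket p z w - bracket p x z * bracket p y w + bracket p x w * bracket p y z =
      0"
  by (simp add: bracket_def cross3_simps)

text \<open>The cofactor matrix, row by row as cross products. For symmetric matrices it is the
  adjugate, and it represents the conic whose tangent lines are the zeros of \<open>B\<close>.\<close>

definition cof :: "real^3^3 \<Rightarrow> real^3^3" where
  "cof B = vector [B$2 \<times> B$3, B$3 \<times> B$1, B$1 \<times> B$2]"

lemma cof_mult_cross: "cof B *v (x \<times> y) = (B *v x) \<times> (B *v y)"
  by (simp add: cof_def matrix_vector_mult_def cross3_simps forall_3)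

lemma cof_transpose: "cof (transpose B) = transpose (cof B)"
  by (simp add: cof_def transpose_def cross3_simps forall_3)

lemma cof_symmetric: "transpose D = D \<Longrightarrow> transpose (cof D) = cof D"
  by (metis cof_transpose)

lemma cof_cof: "cof (cof B) = det B *\<^sub>R B"
  by (simp add: cof_def cross3_simps forall_3)

lemma det_cof: "det (cof B) = (det B)\<^sup>2"
  by (simp add: cof_def cross3_simps forall_3 power2_eq_square)

lemma cof_scaleR: "cof (c *\<^sub>R B) = c\<^sup>2 *\<^sub>R cof B"
  by (simp add: cof_def cross3_simps forall_3 power2_eq_square)

lemma mult_inner_cof_mult: "(B *v x) \<bullet> (cof B *v y) = det B * (x \<bullet> y)"
  by (simp add: cof_def matrix_vector_mult_def cross3_simps)

lemma bracket_mult: "bracket (B *v x) (B *v y) (B *v z) = det B * bracket x y z"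
  by (simp add: bracket_def mult_inner_cof_mult flip: cof_mult_cross)

lemma symmetric_inner:
  fixes B :: "real^3^3"
  assumes "transpose B = B"
  shows "x \<bullet> (B *v y) = y \<bullet> (B *v x)"
  by (metis assms dot_lmul_matrix inner_commute transpose_matrix_vector)

text \<open>The line with normal vector \<open>e\<close> touches the conic with dual matrix \<open>B\<close>.\<close>

definition vanishes :: "real^3^3 \<Rightarrow> real^3 \<Rightarrow> bool" where
  "vanishes B e \<longleftrightarrow> e \<bullet> (B *v e) = 0"

text \<open>The points of the line with normal vector \<open>e\<close> are the vectors \<open>e \<times> y\<close>. On a tangent line the
  equation of the conic is therefore, up to sign, the square of a linear form: the contact is
  double.\<close>

lemma cof_quadratic_on_tangent:
  assumes "transpose B = B" "vanishes B e"
  shows "(e \<times> y) \<bullet> (cof B *v (e \<times> y)) = - ((B *v e) \<bullet> y)\<^sup>2"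
proof -
  have *: "(e \<times> y) \<bullet> (u \<times> w) = (e \<bullet> u) * (y \<bullet> w) - (e \<bullet> w) * (y \<bullet> u)" for u w
    by (simp add: cross3_simps)
  show ?thesis
    using assms symmetric_inner[OF assms(1), of e y]
    by (simp add: cof_mult_cross * vanishes_def power2_eq_square inner_commute)
qed

text \<open>The product of two determinants is the determinant of the matrix of inner products.\<close>

lemma bracket_mult_bracket:
  "bracket u v w * bracket x y z =
    (u \<bullet> x) * ((v \<bullet> y) * (w \<bullet> z) - (v \<bullet> z) * (w \<bullet> y)) -
    (u \<bullet> y) * ((v \<bullet> x) * (w \<bullet> z) - (v \<bullet> z) * (w \<bullet> x)) +
    (u \<bullet> z) * ((v \<bullet> x) * (w \<bullet> y) - (v \<bullet> y) * (w \<bullet> x))"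
proof -
  have "bracket u v w * bracket x y z = (bracket u v w *\<^sub>R x) \<bullet> (y \<times> z)"
    by (simp add: bracket_def)
  then show ?thesis
    unfolding bracket_cramer by (simp add: dot_cross inner_add_left inner_commute algebra_simps)
qed

text \<open>The Gram matrix of three zeros of the form \<open>B\<close> has zero diagonal, so that its determinant is
  a single product. Non-degeneracy is read off from this product below.\<close>

lemma gram_det_isotropic:
  assumes "transpose B = B" "vanishes B x" "vanishes B y" "vanishes B z"
  shows "det B * (bracket x y z)\<^sup>2 = 2 * (x \<bullet> (B *v y)) * (x \<bullet> (B *v z)) * (y \<bullet> (B *v z))"
proof -
  have "det B * (bracket x y z)\<^sup>2 = bracket x y z * bracket (B *v x) (B *v y) (B *v z)"
    by (simp add: bracket_mult power2_eq_square)
  then show ?thesis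
    using assms symmetric_inner[OF assms(1)]
    by (simp add: bracket_mult_bracket vanishes_def)
qed

text \<open>In the basis \<open>x, y, z\<close> all entries of the Gram matrix of \<open>B\<close> vanish.\<close>

lemma symmetric_eq_0:
  fixes B :: "real^3^3"
  assumes "transpose B = B" "bracket x y z \<noteq> 0" "B *v x = 0"
    "y \<bullet> (B *v y) = 0" "y \<bullet> (B *v z) = 0" "z \<bullet> (B *v z) = 0"
  shows "B = 0"
proof -
  note s = symmetric_inner[OF assms(1)]
  have "B *v y = 0"
    by (rule orthogonal_to_basis_eq_0[OF assms(2)])
      (use assms s[of x y] s[of y z] in \<open>simp_all add: inner_commute\<close>)
  moreover have "B *v z = 0"
    by (rule orthogonal_to_basis_eq_0[OF assms(2)])
      (use assms s[of x z] s[of y z] in \<open>simp_all add: inner_commute\<close>)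
  ultimately have "B *v v = 0" for v
    by (intro orthogonal_to_basis_eq_0[OF assms(2)])
      (use assms(3) s[of x v] s[of y v] s[of z v] in \<open>simp_all add: inner_commute\<close>)
  then show ?thesis
    by (metis matrix_eq matrix_vector_mult_0)
qed

section \<open>Conics touching four lines\<close>

text \<open>The dual conic consisting of the lines through \<open>p\<close> or through \<open>q\<close>.\<close>

definition point_pair :: "real^3 \<Rightarrow> real^3 \<Rightarrow> real^3^3" where
  "point_pair p q = (\<chi> i j. p $ i * q $ j + q $ i * p $ j)"

lemma point_pair_mult: "point_pair p q *v x = (q \<bullet> x) *\<^sub>R p + (p \<bullet> x) *\<^sub>R q"
  by (simp add: point_pair_def matrix_vector_mult_def cross3_simps forall_3)

lemma point_pair_commute: "point_pair q p = point_pair p q"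
  by (simp add: point_pair_def vec_eq_iff algebra_simps)

lemma point_pair_symmetric: "transpose (point_pair p q) = point_pair p q"
  by (simp add: point_pair_def transpose_def vec_eq_iff algebra_simps)

text \<open>Passing to cofactors turns a pair of points into the double line that joins them.\<close>

lemma cof_point_pair: "cof (point_pair p q) = - (\<chi> i j. (p \<times> q) $ i * (p \<times> q) $ j)"
  by (simp add: cof_def point_pair_def cross3_simps forall_3)

text \<open>The dual conics touching \<open>a, b, a', b'\<close>, spanned by the two pairs of opposite vertices of
  the quadrilateral with these consecutive edge-lines.\<close>

definition pencil :: "real^3 \<Rightarrow> real^3 \<Rightarrow> real^3 \<Rightarrow> real^3 \<Rightarrow> real \<Rightarrow> real \<Rightarrow> real^3^3" where
  "pencil a b a' b' s t = s *\<^sub>R point_pair (a \<times> b) (a' \<times> b') + t *\<^sub>R point_pair (a \<times> b') (a' \<times> b)"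

lemma transpose_add_scale:
  fixes A B :: "real^3^3"
  shows "transpose (s *\<^sub>R A + t *\<^sub>R B) = s *\<^sub>R transpose A + t *\<^sub>R transpose B"
  by (simp add: transpose_def vec_eq_iff)

lemma add_scale_mult:
  fixes A B :: "real^3^3"
  shows "(s *\<^sub>R A + t *\<^sub>R B) *v x = s *\<^sub>R (A *v x) + t *\<^sub>R (B *v x)"
  by (simp add: matrix_vector_mult_add_rdistrib scaleR_matrix_vector_assoc)

lemma pencil_symmetric: "transpose (pencil a b a' b' s t) = pencil a b a' b' s t"
  by (simp add: pencil_def transpose_add_scale point_pair_symmetric)

lemma pencil_scaleR: "pencil a b a' b' (c * s) (c * t) = c *\<^sub>R pencil a b a' b' s t"
  by (simp add: pencil_def scaleR_add_right)

lemma pencil_mult: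
  "pencil a b a' b' s t *v x =
    s *\<^sub>R (bracket a' b' x *\<^sub>R (a \<times> b) + bracket a b x *\<^sub>R (a' \<times> b')) +
    t *\<^sub>R (bracket a' b x *\<^sub>R (a \<times> b') + bracket a b' x *\<^sub>R (a' \<times> b))"
  by (simp add: pencil_def add_scale_mult point_pair_mult cross_inner_eq_bracket)

lemma pencil_quadratic:
  "x \<bullet> (pencil a b a' b' s t *v x) =
    2 * (s * bracket a b x * bracket a' b' x + t * bracket a b' x * bracket a' b x)"
  by (simp add: pencil_mult cross_inner_eq_bracket algebra_simps)

lemma pencil_vanishes:
  "vanishes (pencil a b a' b' s t) a" "vanishes (pencil a b a' b' s t) a'"
  "vanishes (pencil a b a' b' s t) b" "vanishes (pencil a b a' b' s t) b'"
  by (simp_all add: vanishes_def pencil_quadratic)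

text \<open>The third degenerate member of the pencil; contracted with one vector on both sides, this is
  the three-term bracket relation.\<close>

lemma pencil_double_line: "pencil a b a' b' 1 (- 1) = point_pair (a \<times> a') (b \<times> b')"
  by (simp add: pencil_def point_pair_def cross3_simps forall_3)

text \<open>The point of contact on an edge-line is a combination of its two vertices, with weights
  linear in the parameters.\<close>

lemma pencil_edge:
  "pencil a b a' b' s t *v a = (s * bracket a a' b') *\<^sub>R (a \<times> b) +
     (t * bracket a a' b) *\<^sub>R (a \<times> b')"
  "pencil a b a' b' s t *v a' = (s * bracket a' a b) *\<^sub>R (a' \<times> b') +
     (t * bracket a' a b') *\<^sub>R (a' \<times> b)"
  "pencil a b a' b' s t *v b = (s * bracket b a' b') *\<^sub>R (a \<times> b) +
     (t * bracket b a b') *\<^sub>R (a' \<times> b)"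
  "pencil a b a' b' s t *v b' = (s * bracket b' a b) *\<^sub>R (a' \<times> b') +
     (t * bracket b' a' b) *\<^sub>R (a \<times> b')"
  by (simp_all add: pencil_mult bracket_rotate)

lemma pencil_swap: "pencil b a b' a' s t = pencil a b a' b' s t"
proof -
  have "point_pair (y \<times> x) (w \<times> z) = point_pair (x \<times> y) (z \<times> w)"
      "point_pair (y \<times> x) (w \<times> z) = point_pair (z \<times> w) (x \<times> y)" for x y z w
    by (simp_all add: point_pair_def cross3_simps forall_3)
  then show ?thesis
    by (simp add: pencil_def)
qed

lemma pencil_opposite: "pencil a' b' a b s t = pencil a b a' b' s t"
  by (simp add: pencil_def point_pair_commute)

text \<open>Four normal vectors of which no three are dependent, in the order in which \<open>Quad\<close> lists the
  edge-lines.\<close>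

locale quadrilateral =
  fixes a b a' b' :: "real^3"
  assumes nz: "bracket a b a' \<noteq> 0" "bracket a b b' \<noteq> 0" "bracket a a' b' \<noteq> 0" "bracket b a' b' \<noteq> 0"
begin

lemma nz_sym: "bracket a a' b \<noteq> 0" "bracket b a b' \<noteq> 0" "bracket a' a b \<noteq> 0" "bracket a' a b' \<noteq> 0"
    "bracket b' a b \<noteq> 0" "bracket b' a' b \<noteq> 0"
  using nz by (metis bracket_rotate bracket_swap neg_equal_0_iff_equal)+

lemma swap: "quadrilateral b a b' a'"
  using nz by unfold_locales (metis bracket_rotate bracket_swap neg_equal_0_iff_equal)+

lemma cross_edges_nonzero: "a \<times> b \<noteq> 0" "a \<times> b' \<noteq> 0" "a' \<times> b' \<noteq> 0" "a' \<times> b \<noteq> 0" "a \<times> a' \<noteq> 0"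
    "b \<times> b' \<noteq> 0"
  using nz[THEN bracket_nonzero_cross] by auto

text \<open>The pencil contains a member that agrees with \<open>B\<close> on \<open>a\<close>, because \<open>B *v a\<close> is orthogonal to
  \<open>a\<close> and hence a combination of \<open>a \<times> b\<close> and \<open>a \<times> b'\<close>. The difference kills \<open>a\<close> and still vanishes
  on the other three lines, which leaves a single entry; vanishing on the fourth line removes that
  one too.\<close>

lemma in_pencil:
  assumes sym: "transpose B = B"
    and van: "vanishes B a" "vanishes B b" "vanishes B a'" "vanishes B b'"
  obtains s t where "B = pencil a b a' b' s t"
proof -
  have "(B *v a) \<bullet> a = 0"
    using van(1) by (simp add: vanishes_def inner_commute)
  \<comment> \<open>the coefficients for which the member of the pencil agrees with \<open>B\<close> on \<open>a\<close>\<close>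
  define s where "s = ((B *v a) \<bullet> b') / (bracket a a' b' * bracket a b b')"
  define t where "t = - ((B *v a) \<bullet> b) / (bracket a a' b * bracket a b b')"
  define M where "M = pencil a b a' b' s t"
  define N where "N = B - M"
  have N: "N *v x = B *v x - M *v x" for x
    by (simp add: N_def matrix_vector_mult_diff_rdistrib)
  have Nsym: "transpose N = N"
    using sym pencil_symmetric[of a b a' b' s t]
    by (simp add: N_def M_def transpose_def vec_eq_iff)
  have Na: "N *v a = 0"
  proof (rule orthogonal_to_basis_eq_0[OF nz(2)])
    show "(N *v a) \<bullet> a = 0"
      using \<open>(B *v a) \<bullet> a = 0\<close> by (simp add: N M_def pencil_edge inner_diff_left inner_add_left
          dot_cross_self cross_inner_eq_bracket)
    show "(N *v a) \<bullet> b = 0"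
      using nz nz_sym bracket_swap(2)[of a b b']
          by (simp add: N M_def pencil_edge inner_diff_left inner_add_left cross_inner_eq_bracket
          t_def)
    show "(N *v a) \<bullet> b' = 0"
      using nz nz_sym by (simp add: N M_def pencil_edge inner_diff_left inner_add_left
          cross_inner_eq_bracket s_def)
  qed
  have Nvan: "b \<bullet> (N *v b) = 0" "a' \<bullet> (N *v a') = 0" "b' \<bullet> (N *v b') = 0"
    using van pencil_vanishes[of a b a' b' s t]
        by (simp_all add: N M_def vanishes_def inner_diff_right)
  have "N = 0"
  proof (rule symmetric_eq_0[OF Nsym nz(1) Na Nvan(1) _ Nvan(2)])
    \<comment> \<open>the fourth line in the basis formed by the other three\<close>
    have e: "bracket a b a' *\<^sub>R b' = (b' \<bullet> (b \<times> a')) *\<^sub>R a + (b' \<bullet> (a' \<times> a)) *\<^sub>R b +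
        (b' \<bullet> (a \<times> b)) *\<^sub>R a'"
      by (simp add: bracket_def cross3_simps forall_3)
    have "b \<bullet> (N *v a') = a' \<bullet> (N *v b)" "N *v a = 0"
      using symmetric_inner[OF Nsym] Na by auto
    define d where "d = bracket a b a'"
    have "(d *\<^sub>R b') \<bullet> (N *v (d *\<^sub>R b')) = 0"
      using Nvan(3) by (simp add: matrix_vector_mult_scaleR)
    then have "2 * (b' \<bullet> (a' \<times> a)) * (b' \<bullet> (a \<times> b)) * (b \<bullet> (N *v a')) = 0"
      unfolding d_def e using Na Nvan(1,2) symmetric_inner[OF Nsym, of a b] symmetric_inner[OF
          Nsym, of a a'] symmetric_inner[OF Nsym, of a' b]
      by (auto simp: matrix_vector_right_distrib matrix_vector_mult_scaleR inner_add_left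
          inner_add_right)
    then show "b \<bullet> (N *v a') = 0"
      using nz_sym by (metis bracket_def bracket_rotate bracket_swap(1) mult_eq_0_iff
          neg_equal_0_iff_equal zero_neq_numeral)
  qed
  then show thesis
    using that M_def N_def by simp
qed

lemma pencil_nonzero_on_edge:
  assumes "s \<noteq> 0 \<or> t \<noteq> 0"
  shows "pencil a b a' b' s t *v a \<noteq> 0"
proof
  assume "pencil a b a' b' s t *v a = 0"
  then have "(pencil a b a' b' s t *v a) \<bullet> b = 0" "(pencil a b a' b' s t *v a) \<bullet> b' = 0"
    by auto
  then show False
    using assms nz nz_sym bracket_swap(2)[of a b b']
        by (auto simp: pencil_edge inner_add_left cross_inner_eq_bracket)
qed

text \<open>Only the three pairs of points are degenerate: the off-diagonal entries of the Gram matrix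
  of \<open>a, a', b\<close> are multiples of \<open>s + t\<close>, \<open>t\<close> and \<open>s\<close>.\<close>

lemma det_pencil_eq_0_iff: "det (pencil a b a' b' s t) = 0 \<longleftrightarrow> s = 0 \<or> t = 0 \<or> s + t = 0"
proof -
  let ?B = "pencil a b a' b' s t"
  have r: "bracket a' b' a = bracket a a' b'" "bracket a' b a = bracket a a' b"
      "bracket a' a b = - bracket a a' b"
    "bracket a' a b' = - bracket a a' b'"
    using bracket_rotate[of a' b' a] bracket_rotate[of a' b a] bracket_swap(1)[of a' a b]
        bracket_swap(1)[of a' a b'] by simp_all
  have e1: "a \<bullet> (?B *v a') = - (s + t) * bracket a a' b * bracket a a' b'"
    by (simp add: pencil_edge inner_add_right cross_inner_eq_bracket r)
      (simp add: algebra_simps flip: bracket_def)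
  have e2: "a \<bullet> (?B *v b) = t * bracket b a b' * bracket a' b a"
    by (simp add: pencil_edge inner_add_right cross_inner_eq_bracket)
  have e3: "a' \<bullet> (?B *v b) = s * bracket b a' b' * bracket a b a'"
    by (simp add: pencil_edge inner_add_right cross_inner_eq_bracket)
  define K where "K = - 2 * bracket a a' b * bracket a a' b' * bracket b a b' * bracket a' b a *
      bracket b a' b' * bracket a b a'"
  have "det ?B * (bracket a a' b)\<^sup>2 = s * t * (s + t) * K"
    unfolding gram_det_isotropic[OF pencil_symmetric pencil_vanishes(1,2,3)] e1 e2 e3 K_def
    by (simp add: algebra_simps)
  moreover have "K \<noteq> 0"
    using nz nz_sym by (simp add: K_def r)
  ultimately show ?thesis
    using nz_sym(1) by (metis mult_eq_0_iff power_not_zero)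
qed

lemma opposite: "quadrilateral a' b' a b"
  using nz by unfold_locales (metis bracket_rotate bracket_swap neg_equal_0_iff_equal)+

lemma opposite_edges_inner: "(a \<times> b) \<bullet> ((a \<times> a') \<times> (b \<times> b')) = - bracket a a' b * bracket a b b'"
  by (simp add: cross_cross_bracket inner_diff_right cross_inner_eq_bracket)

lemma opposite_edges_cross_nonzero: "(a \<times> a') \<times> (b \<times> b') \<noteq> 0"
  using opposite_edges_inner nz nz_sym by (metis inner_zero_right mult_eq_0_iff
      neg_equal_0_iff_equal)

end

section \<open>Homogeneous coordinates\<close>

definition point_of :: "real^3 \<Rightarrow> proj_point" where
  "point_of v = Abs_proj_point (span {v})"

text \<open>A chosen representative; normal vectors are unique up to a nonzero scalar factor.\<close>

definition normal :: "proj_line \<Rightarrow> real^3" where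
  "normal a = (SOME n. n \<noteq> 0 \<and> line_space a = {v. n \<bullet> v = 0})"

lemma point_space_point_of: "v \<noteq> 0 \<Longrightarrow> point_space (point_of v) = span {v}"
  unfolding point_of_def by (rule Abs_proj_point_inverse) (simp add: dim_span)

lemma point_of_cases:
  obtains v where "v \<noteq> 0" "p = point_of v"
proof -
  have S: "subspace (point_space p)" "dim (point_space p) = 1"
    using point_space[of p] by auto
  then obtain v where v: "v \<in> point_space p" "v \<noteq> 0"
    by (metis dim_eq_0 singletonI subsetI zero_neq_one)
  have "span {v} \<subseteq> point_space p"
    by (rule span_minimal) (use S v in auto)
  then have "span {v} = point_space p"
    by (rule subspace_dim_equal[rotated 2]) (use S v in \<open>auto simp: dim_span\<close>)
  then have "p = point_of v"
    by (metis point_of_def point_space_inverse)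
  then show thesis
    using v that by blast
qed

lemma point_of_eq_iff:
  assumes "v \<noteq> 0" "w \<noteq> 0"
  shows "point_of v = point_of w \<longleftrightarrow> v \<times> w = 0"
proof
  assume "point_of v = point_of w"
  then have "v \<in> span {w}"
    using assms by (metis point_space_point_of singletonI span_superset subsetD)
  then show "v \<times> w = 0"
    by (auto simp: span_singleton cross_mult_left)
next
  assume "v \<times> w = 0"
  then obtain c where "v = c *\<^sub>R w"
    using assms parallelE by blast
  moreover have "span {c *\<^sub>R w} = span {w}" if "c \<noteq> 0"
    using span_image_scale[of "{w}" "\<lambda>_. c"] that by simp
  ultimately show "point_of v = point_of w"
    using assms by (auto simp: point_of_def)
qed

lemma combination_nonzero:
  assumes "p \<times> q \<noteq> 0" "x \<noteq> 0 \<or> y \<noteq> 0"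
  shows "x *\<^sub>R p + y *\<^sub>R q \<noteq> 0"
proof
  assume "x *\<^sub>R p + y *\<^sub>R q = 0"
  then have "(x *\<^sub>R p + y *\<^sub>R q) \<times> q = 0" "(x *\<^sub>R p + y *\<^sub>R q) \<times> p = 0"
    by simp_all
  then show False
    using assms cross_skew[of q p] by (simp add: cross_add_left cross_mult_left)
qed

lemma point_of_combination_eq_iff:
  assumes "p \<times> q \<noteq> 0" "x \<noteq> 0 \<or> y \<noteq> 0" "z \<noteq> 0 \<or> w \<noteq> 0"
  shows "point_of (x *\<^sub>R p + y *\<^sub>R q) = point_of (z *\<^sub>R p + w *\<^sub>R q) \<longleftrightarrow> x * w = y * z"
proof -
  have c: "(x *\<^sub>R p + y *\<^sub>R q) \<times> (z *\<^sub>R p + w *\<^sub>R q) = (x * w - y * z) *\<^sub>R (p \<times> q)" for x y z w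
    by (simp add: cross3_simps forall_3)
  have nz: "x *\<^sub>R p + y *\<^sub>R q \<noteq> 0" if "x \<noteq> 0 \<or> y \<noteq> 0" for x y
    using c[of x y 0 1] c[of x y 1 0] assms(1) that by auto
  show ?thesis
    by (subst point_of_eq_iff) (use nz assms c[of x y z w] in auto)
qed

lemma point_of_eqI:
  assumes "x \<times> y \<noteq> 0" "u \<noteq> 0" "v \<noteq> 0" "u \<bullet> x = 0" "u \<bullet> y = 0" "v \<bullet> x = 0" "v \<bullet> y = 0"
  shows "point_of u = point_of v"
proof -
  obtain c where "u = c *\<^sub>R (x \<times> y)"
    using parallel_cross assms(1,4,5) by blast
  moreover obtain d where "v = d *\<^sub>R (x \<times> y)"
    using parallel_cross assms(1,6,7) by blast
  ultimately show ?thesis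
    using assms by (simp add: point_of_eq_iff cross_mult_left cross_mult_right)
qed

lemma normal: "normal a \<noteq> 0" "line_space a = {v. normal a \<bullet> v = 0}"
proof -
  have S: "subspace (line_space a)" "dim (line_space a) = 2"
    using line_space[of a] by auto
  then have "dim (line_space a) = DIM(real^3) - 1"
    by simp
  then obtain n where "n \<noteq> 0" "span (line_space a) = {v. n \<bullet> v = 0}"
    by (rule lowdim_eq_hyperplane)
  then have "\<exists>n. n \<noteq> 0 \<and> line_space a = {v. n \<bullet> v = 0}"
    using S by (metis span_eq_iff)
  from someI_ex[OF this] show "normal a \<noteq> 0" "line_space a = {v. normal a \<bullet> v = 0}"
    unfolding normal_def by blast+
qed

lemma ex_line_with_normal:
  assumes "n \<noteq> 0"
  obtains a where "line_space a = {v. n \<bullet> v = 0}"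
proof -
  have "dim {v. n \<bullet> v = 0} = 2"
    using dim_hyperplane[OF assms] by simp
  then show thesis
    using that Abs_proj_line_inverse[of "{v. n \<bullet> v = 0}"] subspace_hyperplane by blast
qed

lemma on_line_iff:
  assumes "v \<noteq> 0" "line_space a = {v. n \<bullet> v = 0}"
  shows "on_line (point_of v) a \<longleftrightarrow> n \<bullet> v = 0"
proof
  assume "on_line (point_of v) a"
  then show "n \<bullet> v = 0"
    using span_base[of v "{v}"] unfolding on_line_def point_space_point_of[OF assms(1)] assms(2)
        by blast
next
  assume "n \<bullet> v = 0"
  then show "on_line (point_of v) a"
    unfolding on_line_def point_space_point_of[OF assms(1)] assms(2) by (auto simp: span_singleton)
qed

lemmas on_line_point_of = on_line_iff[OF _ normal(2)]

lemma line_eqI: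
  assumes "normal a \<times> normal b = 0"
  shows "a = b"
proof -
  obtain c where c: "normal a = c *\<^sub>R normal b"
    using assms parallelE normal(1) by blast
  then have "c \<noteq> 0"
    using normal(1)[of a] by auto
  then have "line_space a = line_space b"
    using c by (simp add: normal)
  then show ?thesis
    by (simp add: line_space_inject)
qed

lemma parallel_normal:
  assumes "line_space a = {v. n \<bullet> v = 0}"
  obtains c where "c \<noteq> 0" "n = c *\<^sub>R normal a"
proof -
  have "n \<noteq> 0"
    using assms normal[of a] by (metis (mono_tags) Collect_cong inner_eq_zero_iff inner_zero_left
        mem_Collect_eq)
  have "n \<times> normal a = 0"
  proof (rule ccontr)
    let ?y = "normal a \<times> (n \<times> normal a)"
    assume "n \<times> normal a \<noteq> 0"
    have "normal a \<bullet> ?y = 0"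
      by (simp add: dot_cross_self)
    then have "n \<bullet> ?y = 0"
      using assms normal(2)[of a] by auto
    moreover have "n \<bullet> ?y = (n \<times> normal a) \<bullet> (n \<times> normal a)"
      by (simp add: cross3_simps)
    ultimately show False
      using \<open>n \<times> normal a \<noteq> 0\<close> by simp
  qed
  then obtain c where "n = c *\<^sub>R normal a"
    using parallelE normal(1) by blast
  then show thesis
    using that \<open>n \<noteq> 0\<close> by auto
qed

lemma meet_eqI:
  assumes "a \<noteq> b" "on_line p a" "on_line p b"
  shows "meet a b = p"
  unfolding meet_def
proof (rule the_equality)
  fix q assume q: "on_line q a \<and> on_line q b"
  obtain v w where v: "v \<noteq> 0" "p = point_of v" and w: "w \<noteq> 0" "q = point_of w"
    by (metis point_of_cases)
  have nz: "normal a \<times> normal b \<noteq> 0"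
    using assms(1) line_eqI by blast
  have "u \<times> (normal a \<times> normal b) = 0" if "u \<bullet> normal a = 0" "u \<bullet> normal b = 0" for u
    using that by (simp add: Lagrange)
  then have "v \<times> (normal a \<times> normal b) = 0" "w \<times> (normal a \<times> normal b) = 0"
    using assms q v w by (simp_all add: on_line_point_of inner_commute)
  then show "q = p"
    using v w nz point_of_eq_iff by metis
qed (use assms in simp)

lemma on_line_meet:
  assumes "a \<noteq> b"
  shows "on_line (meet a b) a" "on_line (meet a b) b"
    and "meet a b = point_of (normal a \<times> normal b)"
proof -
  have "normal a \<times> normal b \<noteq> 0"
    using assms line_eqI by blast
  then have "on_line (point_of (normal a \<times> normal b)) a"
      "on_line (point_of (normal a \<times> normal b)) b"
    by (simp_all add: on_line_point_of dot_cross_self)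
  then show "on_line (meet a b) a" "on_line (meet a b) b"
    and "meet a b = point_of (normal a \<times> normal b)"
    using assms meet_eqI by simp_all
qed

lemma meet_commute: "meet a b = meet b a"
  unfolding meet_def by meson

lemma line_space_join:
  assumes "v \<noteq> 0" "w \<noteq> 0" "v \<times> w \<noteq> 0"
  shows "line_space (join (point_of v) (point_of w)) = {x. (v \<times> w) \<bullet> x = 0}"
proof -
  obtain a where a: "line_space a = {x. (v \<times> w) \<bullet> x = 0}"
    using ex_line_with_normal assms(3) by blast
  have "join (point_of v) (point_of w) = a"
    unfolding join_def
  proof (rule the_equality)
    show "on_line (point_of v) a \<and> on_line (point_of w) a"
      using assms a by (simp add: on_line_iff dot_cross_self)
    fix b assume "on_line (point_of v) b \<and> on_line (point_of w) b"
    then have "normal b \<bullet> v = 0" "normal b \<bullet> w = 0"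
      using assms by (simp_all add: on_line_point_of)
    then obtain c where "normal b = c *\<^sub>R (v \<times> w)"
      using parallel_cross assms(3) by blast
    moreover obtain d where "v \<times> w = d *\<^sub>R normal a"
      using parallel_normal[OF a] by blast
    ultimately show "b = a"
      by (intro line_eqI) (simp add: cross_mult_left)
  qed
  then show ?thesis
    using a by simp
qed

lemma bracket_normal_eq_0:
  assumes "a \<noteq> b" "bracket (normal a) (normal b) (normal c) = 0"
  shows "\<exists>p. on_line p a \<and> on_line p b \<and> on_line p c"
proof -
  have "normal a \<times> normal b \<noteq> 0"
    using assms line_eqI by blast
  then have "on_line (point_of (normal a \<times> normal b)) c"
    using assms(2) by (simp add: on_line_point_of cross_inner_eq_bracket bracket_rotate)
  then show ?thesis
    using on_line_meet[OF assms(1)] by metis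
qed

lemma proj_collinear_point_of:
  assumes "g \<noteq> 0" "\<And>p. p \<in> S \<Longrightarrow> \<exists>v. v \<noteq> 0 \<and> p = point_of v \<and> g \<bullet> v = 0"
  shows "proj_collinear S"
proof -
  obtain a where "line_space a = {v. g \<bullet> v = 0}"
    using ex_line_with_normal assms(1) by blast
  then show ?thesis
    using assms(2) unfolding proj_collinear_def by (metis on_line_iff)
qed

section \<open>Conics and their dual matrices\<close>

definition conic_of :: "real^3^3 \<Rightarrow> conic" where
  "conic_of A = Abs_conic (span {A})"

lemma conic_space_conic_of:
  "transpose A = A \<Longrightarrow> A \<noteq> 0 \<Longrightarrow> conic_space (conic_of A) = span {A}"
  unfolding conic_of_def by (rule Abs_conic_inverse) blast

lemma conic_of_cases:
  obtains A where "transpose A = A" "A \<noteq> 0" "C = conic_of A"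
  using conic_space[of C] conic_space_inverse[of C] unfolding conic_of_def by auto

lemma conic_of_scaleR: "c \<noteq> 0 \<Longrightarrow> conic_of (c *\<^sub>R A) = conic_of A"
  using span_image_scale[of "{A}" "\<lambda>_. c"] by (simp add: conic_of_def)

lemma det_scaleR: "det (c *\<^sub>R (A :: real^3^3)) = c ^ 3 * det A"
  by (simp add: det_3 power3_eq_cube algebra_simps)

lemma scaleR_quadratic: "x \<bullet> ((c *\<^sub>R A) *v y) = c * (x \<bullet> (A *v y))" for A :: "real^3^3"
  by (simp add: scaleR_matrix_vector_assoc[symmetric])

lemma ball_span_singleton: "(\<forall>x\<in>span {y}. P x) \<longleftrightarrow> (\<forall>c. P (c *\<^sub>R y))"
  by (auto simp: span_singleton)

lemma bex_span_singleton: "(\<exists>x\<in>span {y}. P x) \<longleftrightarrow> (\<exists>c. P (c *\<^sub>R y))"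
  by (auto simp: span_singleton)

lemma ex_nonzero_scalar: "\<not> (\<forall>c :: real. c = 0)"
  by (metis zero_neq_one)

lemma conic_of_simps:
  assumes "transpose A = A" "A \<noteq> 0"
  shows "nondegenerate (conic_of A) \<longleftrightarrow> det A \<noteq> 0"
    and "v \<noteq> 0 \<Longrightarrow> on_conic (point_of v) (conic_of A) \<longleftrightarrow> v \<bullet> (A *v v) = 0"
    and "v \<noteq> 0 \<Longrightarrow> tangent_at (conic_of A) a (point_of v) \<longleftrightarrow>
      normal a \<bullet> v = 0 \<and> v \<bullet> (A *v v) = 0 \<and> (\<forall>w. normal a \<bullet> w = 0 \<longrightarrow> w \<bullet> (A *v v) = 0)"
proof -
  show "nondegenerate (conic_of A) \<longleftrightarrow> det A \<noteq> 0"
    unfolding nondegenerate_def conic_space_conic_of[OF assms]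
    by (auto simp: bex_span_singleton det_scaleR intro: exI[of _ 1])
  show *: "on_conic (point_of v) (conic_of A) \<longleftrightarrow> v \<bullet> (A *v v) = 0" if "v \<noteq> 0"
    unfolding on_conic_def conic_space_conic_of[OF assms] point_space_point_of[OF that]
    by (simp add: ball_span_singleton scaleR_quadratic matrix_vector_mult_scaleR ex_nonzero_scalar)
  show "tangent_at (conic_of A) a (point_of v) \<longleftrightarrow>
      normal a \<bullet> v = 0 \<and> v \<bullet> (A *v v) = 0 \<and> (\<forall>w. normal a \<bullet> w = 0 \<longrightarrow> w \<bullet> (A *v v) = 0)" if "v \<noteq> 0"
  proof -
    have "(\<forall>c d w. normal a \<bullet> w = 0 \<longrightarrow> w \<bullet> ((c *\<^sub>R A) *v (d *\<^sub>R v)) = 0) \<longleftrightarrow>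
        (\<forall>w. normal a \<bullet> w = 0 \<longrightarrow> w \<bullet> (A *v v) = 0)" (is "?l \<longleftrightarrow> ?r")
    proof
      assume ?l
      from this[THEN spec[of _ 1], THEN spec[of _ 1]] show ?r
        by simp
    qed (simp add: scaleR_quadratic matrix_vector_mult_scaleR)
    then show ?thesis
      unfolding tangent_at_def *[OF that] on_line_point_of[OF that] conic_space_conic_of[OF assms]
        point_space_point_of[OF that] normal(2)[of a] ball_span_singleton by simp
  qed
qed

definition dual_conic :: "real^3^3 \<Rightarrow> conic" where
  "dual_conic B = conic_of (cof B)"

lemma dual_conic_scaleR: "c \<noteq> 0 \<Longrightarrow> dual_conic (c *\<^sub>R B) = dual_conic B"
  by (simp add: dual_conic_def cof_scaleR conic_of_scaleR)

lemma cof_nonzero: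
  assumes "transpose B = B" "vanishes B e" "e \<noteq> 0" "B *v e \<noteq> 0"
  shows "cof B \<noteq> 0"
  using cof_quadratic_on_tangent[OF assms(1,2), of "B *v e"] assms by auto

text \<open>On the tangent line \<open>e\<close> the conic is a squared linear form with the single zero
  \<open>B *v normal e\<close>.\<close>

lemma on_conic_dual_iff:
  assumes B: "transpose B = B" "vanishes B (normal e)" "B *v normal e \<noteq> 0" and p: "on_line p e"
  shows "on_conic p (dual_conic B) \<longleftrightarrow> p = point_of (B *v normal e)"
proof -
  define n where "n = normal e"
  obtain v where v: "v \<noteq> 0" "p = point_of v"
    by (rule point_of_cases)
  have nv: "n \<bullet> v = 0"
    using p v by (simp add: on_line_point_of n_def)
  have n: "n \<noteq> 0" "B *v n \<noteq> 0" "n \<bullet> (B *v n) = 0"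
    using normal(1) B by (auto simp: n_def vanishes_def)
  have nn: "n \<times> (v \<times> n) = (n \<bullet> n) *\<^sub>R v"
    by (simp add: Lagrange nv)
  have sym: "transpose (cof B) = cof B"
    by (metis B(1) cof_transpose)
  have nzc: "cof B \<noteq> 0"
    using cof_nonzero B normal(1) by blast
  have "(n \<bullet> n)\<^sup>2 * (v \<bullet> (cof B *v v)) = - ((B *v n) \<bullet> (v \<times> n))\<^sup>2"
    using cof_quadratic_on_tangent[of B n "v \<times> n"] B
    unfolding nn by (simp add: n_def matrix_vector_mult_scaleR power2_eq_square)
  then have "on_conic p (dual_conic B) \<longleftrightarrow> (B *v n) \<bullet> (v \<times> n) = 0"
    using n v nzc sym by (auto simp: dual_conic_def conic_of_simps)
  also have "\<dots> \<longleftrightarrow> n \<bullet> ((B *v n) \<times> v) = 0"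
    by (simp add: cross3_simps)
  also have "\<dots> \<longleftrightarrow> (B *v n) \<times> v = 0"
  proof
    assume "n \<bullet> ((B *v n) \<times> v) = 0"
    moreover have "n \<times> ((B *v n) \<times> v) = 0"
      using n nv by (simp add: Lagrange)
    ultimately show "(B *v n) \<times> v = 0"
      using norm_and_cross_eq_0 n(1) by blast
  qed simp
  also have "\<dots> \<longleftrightarrow> p = point_of (B *v n)"
    using point_of_eq_iff[OF n(2) v(1)] v(2) by auto
  finally show ?thesis
    by (simp add: n_def)
qed

lemma tangency_point_dual:
  assumes "transpose B = B" "vanishes B (normal e)" "B *v normal e \<noteq> 0"
  shows "tangency_point (dual_conic B) e = point_of (B *v normal e)"
proof -
  have "on_line (point_of (B *v normal e)) e"
    using assms by (simp add: on_line_point_of vanishes_def)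
  then show ?thesis
    unfolding tangency_point_def using on_conic_dual_iff[OF assms] by blast
qed

lemma cof_mult_mult:
  assumes "transpose B = B"
  shows "cof B *v (B *v x) = det B *\<^sub>R x" "B *v (cof B *v x) = det B *\<^sub>R x"
proof -
  have sym: "transpose (cof B) = cof B"
    by (metis assms cof_transpose)
  have "y \<bullet> (cof B *v (B *v x)) = y \<bullet> (det B *\<^sub>R x)" for y
    unfolding symmetric_inner[OF sym, of y "B *v x"] mult_inner_cof_mult inner_scaleR_right
    by (simp add: inner_commute)
  then show "cof B *v (B *v x) = det B *\<^sub>R x"
    by (rule vector_eq_ldot[THEN iffD1, OF allI])
  have "y \<bullet> (B *v (cof B *v x)) = y \<bullet> (det B *\<^sub>R x)" for y
    using mult_inner_cof_mult[of B y x] symmetric_inner[OF assms, of y "cof B *v x"]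
    by (metis inner_commute inner_scaleR_right)
  then show "B *v (cof B *v x) = det B *\<^sub>R x"
    by (rule vector_eq_ldot[THEN iffD1, OF allI])
qed

lemma tangent_at_dual:
  assumes "transpose B = B" "vanishes B (normal e)" "B *v normal e \<noteq> 0"
  shows "tangent_at (dual_conic B) e (point_of (B *v normal e))"
  using assms cof_nonzero[OF assms(1,2) normal(1) assms(3)]
  by (auto simp: dual_conic_def conic_of_simps cof_transpose[symmetric] cof_mult_mult vanishes_def
      inner_commute)

lemma nondegenerate_dual_iff:
  assumes "transpose B = B" "cof B \<noteq> 0"
  shows "nondegenerate (dual_conic B) \<longleftrightarrow> det B \<noteq> 0"
  using assms by (simp add: dual_conic_def conic_of_simps cof_transpose[symmetric] det_cof)

lemma det_nonzero_mult:
  fixes B :: "real^3^3"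
  assumes "transpose B = B" "det B \<noteq> 0" "x \<noteq> 0"
  shows "B *v x \<noteq> 0"
  using cof_mult_mult(1)[OF assms(1), of x] assms by auto

lemma det_nonzero_cof: "det (B :: real^3^3) \<noteq> 0 \<Longrightarrow> cof B \<noteq> 0"
  using det_cof[of B] by (auto simp: det_3)

text \<open>The dual matrix of a conic with matrix \<open>A\<close> is \<open>cof A\<close>, since taking cofactors twice gives a
  multiple of \<open>A\<close>.\<close>

lemma nondegenerate_cases:
  assumes "nondegenerate C"
  obtains B where "transpose B = B" "det B \<noteq> 0" "C = dual_conic B"
proof -
  obtain A where A: "transpose A = A" "A \<noteq> 0" "C = conic_of A"
    by (rule conic_of_cases)
  then have "det A \<noteq> 0"
    using assms conic_of_simps by auto
  then have "C = dual_conic (cof A)"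
    using A by (simp add: dual_conic_def cof_cof conic_of_scaleR)
  then show thesis
    using that[of "cof A"] A \<open>det A \<noteq> 0\<close> by (simp add: cof_transpose[symmetric] det_cof)
qed

text \<open>If \<open>e\<close> touches the conic at \<open>v\<close>, then \<open>cof B *v v\<close> is normal to \<open>e\<close>; applying \<open>B\<close> shows that
  \<open>v\<close> is the pole \<open>B *v normal e\<close>, and \<open>v\<close> lying on \<open>e\<close> is the vanishing of the form.\<close>

lemma tangent_dual_iff:
  assumes B: "transpose B = B" "det B \<noteq> 0"
  shows "tangent (dual_conic B) e \<longleftrightarrow> vanishes B (normal e)"
proof
  assume "vanishes B (normal e)"
  then show "tangent (dual_conic B) e"
    using tangent_at_dual[OF B(1), of e] det_nonzero_mult[OF B normal(1)]
    unfolding tangent_def by blast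
next
  assume "tangent (dual_conic B) e"
  then obtain v where v: "v \<noteq> 0" "tangent_at (dual_conic B) e (point_of v)"
    unfolding tangent_def by (metis point_of_cases)
  let ?u = "cof B *v v"
  have nv: "normal e \<bullet> v = 0" and w: "\<And>w. normal e \<bullet> w = 0 \<Longrightarrow> w \<bullet> ?u = 0"
    using v B det_nonzero_cof[OF B(2)] by (auto simp: dual_conic_def conic_of_simps
        cof_transpose[symmetric])
  have "?u \<times> normal e = 0"
  proof -
    have "normal e \<bullet> (?u \<times> normal e) = 0" "normal e \<bullet> (normal e \<times> (?u \<times> normal e)) = 0"
      by (simp_all add: dot_cross_self)
    then have "(normal e \<times> (?u \<times> normal e)) \<bullet> ?u = 0"
      using w by blast
    moreover have "(n \<times> (u \<times> n)) \<bullet> u = (u \<times> n) \<bullet> (u \<times> n)" for n u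
      by (simp add: cross3_simps)
    ultimately show ?thesis
      by (metis inner_eq_zero_iff)
  qed
  then obtain c where "?u = c *\<^sub>R normal e"
    using parallelE normal(1) by blast
  then have "det B *\<^sub>R v = c *\<^sub>R (B *v normal e)"
    using cof_mult_mult(2)[OF B(1), of v] by (simp add: matrix_vector_mult_scaleR)
  moreover from this have "c \<noteq> 0"
    using B v by auto
  ultimately show "vanishes B (normal e)"
    using nv unfolding vanishes_def by (metis inner_scaleR_right mult_eq_0_iff)
qed

lemma is_double_line_iff:
  assumes "p \<times> q \<noteq> 0" "line_space a = {v. (p \<times> q) \<bullet> v = 0}"
  shows "is_double_line C a \<longleftrightarrow> C = dual_conic (point_pair p q)"
proof -
  let ?m = "\<lambda>d :: real^3. (\<chi> i j. d $ i * d $ j) :: real^3^3"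
  have dual_conic: "dual_conic (point_pair p q) = conic_of (?m (p \<times> q))"
    using conic_of_scaleR[of "-1"] by (simp add: dual_conic_def cof_point_pair)
  have sc: "?m (c *\<^sub>R d) = c\<^sup>2 *\<^sub>R ?m d" for c d
    by (simp add: vec_eq_iff power2_eq_square)
  have m: "conic_of (?m d) = conic_of (?m (p \<times> q))" if d: "line_space a = {v. d \<bullet> v = 0}" for d
  proof -
    obtain x y where xy: "x \<noteq> 0" "y \<noteq> 0" "d = x *\<^sub>R normal a" "p \<times> q = y *\<^sub>R normal a"
      using parallel_normal[OF d] parallel_normal[OF assms(2)] by metis
    then show ?thesis
      unfolding xy(3,4) sc by (simp add: conic_of_scaleR)
  qed
  have m0: "transpose (?m d) = ?m d" "d \<noteq> 0 \<Longrightarrow> ?m d \<noteq> 0" for d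
    by (auto simp: transpose_def vec_eq_iff mult.commute)
  show ?thesis
  proof
    assume "is_double_line C a"
    then obtain d where d: "line_space a = {v. d \<bullet> v = 0}" "conic_space C = span {?m d}"
      unfolding is_double_line_def by auto
    then have "C = conic_of (?m d)"
      by (metis conic_space_inverse conic_of_def)
    then show "C = dual_conic (point_pair p q)"
      using m[OF d(1)] dual_conic by simp
  next
    assume "C = dual_conic (point_pair p q)"
    then show "is_double_line C a"
      unfolding is_double_line_def using assms m0 dual_conic conic_space_conic_of by metis
  qed
qed

section \<open>Inscribed conics\<close>

text \<open>The member of the pencil with parameter \<open>c\<close>; the missing parameters \<open>0\<close> and \<open>\<infinity>\<close> are the
  pairs of opposite vertices.\<close>

fun inscribed_conic :: "quad \<Rightarrow> real \<Rightarrow> conic" where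
  "inscribed_conic (Quad a b a' b') c =
    dual_conic (pencil (normal a) (normal b) (normal a') (normal b') c 1)"

locale quad_lines =
  fixes a b a' b' :: proj_line
  assumes quadrilateral: "quadrilateral (normal a) (normal b) (normal a') (normal b')"
begin

sublocale quadrilateral "normal a" "normal b" "normal a'" "normal b'"
  by (rule quadrilateral)

abbreviation "pen \<equiv> pencil (normal a) (normal b) (normal a') (normal b')"
abbreviation "Q \<equiv> Quad a b a' b'"

lemma edges_distinct: "a \<noteq> b" "a \<noteq> b'" "a' \<noteq> b'" "a' \<noteq> b" "a \<noteq> a'" "b \<noteq> b'"
  using cross_edges_nonzero by auto

text \<open>Pencil and vertices do not change when the quadrilateral is read from another edge. So it
  suffices to study one edge.\<close>

lemma edge_as_first:
  assumes "e \<in> edge_lines Q"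
  obtains x e' y where "quad_lines e x e' y" "vertices (Quad e x e' y) = vertices Q"
    "edge_lines (Quad e x e' y) = edge_lines Q"
    "\<forall>s t. pencil (normal e) (normal x) (normal e') (normal y) s t = pen s t"
proof -
  consider "e = a" | "e = b" | "e = a'" | "e = b'"
    using assms by auto
  then show thesis
  proof cases
    case 1
    then show ?thesis
      using that[of b a' b'] quad_lines_axioms by simp
  next
    case 2
    then show ?thesis
      using that[of a b' a'] quad_lines.intro[OF swap]
      by (auto simp: pencil_swap meet_commute)
  next
    case 3
    then show ?thesis
      using that[of b' a b] quad_lines.intro[OF opposite]
      by (auto simp: pencil_opposite)
  next
    case 4
    then show ?thesis
      using that[of a' b a] quad_lines.intro[OF quadrilateral.swap[OF opposite]]
      by (auto simp: pencil_swap pencil_opposite meet_commute)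
  qed
qed

lemma first_edge_mult:
  "pen s t *v normal a = (s * bracket (normal a) (normal a') (normal b')) *\<^sub>R (normal a \<times> normal
      b) +
    (t * bracket (normal a) (normal a') (normal b)) *\<^sub>R (normal a \<times> normal b')"
  by (rule pencil_edge)

lemma first_edges_cross_nonzero: "(normal a \<times> normal b) \<times> (normal a \<times> normal b') \<noteq> 0"
  using nz(2) normal(1)[of a] by (simp add: cross_cross_bracket)

text \<open>The vertices on \<open>a\<close> are the two summands themselves; the other two vertices are not on \<open>a\<close>.\<close>

lemma combination_not_vertex:
  assumes "x \<noteq> 0" "y \<noteq> 0"
  shows "point_of (x *\<^sub>R (normal a \<times> normal b) + y *\<^sub>R (normal a \<times> normal b')) \<notin> vertices Q"
proof -
  let ?p = "point_of (x *\<^sub>R (normal a \<times> normal b) + y *\<^sub>R (normal a \<times> normal b'))"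
  note c = point_of_combination_eq_iff[OF first_edges_cross_nonzero]
  have "x *\<^sub>R (normal a \<times> normal b) + y *\<^sub>R (normal a \<times> normal b') \<noteq> 0"
    using assms by (intro combination_nonzero first_edges_cross_nonzero) simp
  then have "on_line ?p a"
    by (simp add: on_line_point_of inner_add_right dot_cross_self)
  moreover have "\<not> on_line (meet a' b') a" "\<not> on_line (meet a' b) a"
    unfolding on_line_meet(3)[OF edges_distinct(3)] on_line_meet(3)[OF edges_distinct(4)]
      on_line_point_of[OF cross_edges_nonzero(3)] on_line_point_of[OF cross_edges_nonzero(4)]
    using nz(3) nz_sym(1) by (simp_all add: bracket_def)
  moreover have "?p \<noteq> meet a b" "?p \<noteq> meet a b'"
    using c[of x y 1 0] c[of x y 0 1] assms edges_distinct by (simp_all add: on_line_meet(3))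
  ultimately show ?thesis
    by auto
qed

lemma pencil_edge_nonzero:
  assumes "e \<in> edge_lines Q" "s \<noteq> 0 \<or> t \<noteq> 0"
  shows "pen s t *v normal e \<noteq> 0"
proof -
  obtain x e' y where x: "quad_lines e x e' y" "vertices (Quad e x e' y) = vertices Q"
      "edge_lines (Quad e x e' y) = edge_lines Q"
      "\<forall>s t. pencil (normal e) (normal x) (normal e') (normal y) s t = pen s t"
    by (rule edge_as_first[OF assms(1)])
  interpret E: quad_lines e x e' y by (rule x)
  show ?thesis
    using E.pencil_nonzero_on_edge[OF assms(2)] by (simp add: x(4))
qed

lemma pencil_edge_vanishes: "e \<in> edge_lines Q \<Longrightarrow> vanishes (pen s t) (normal e)"
  by (auto simp: pencil_vanishes)

lemma tangency_point_pencil: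
  assumes "e \<in> edge_lines Q" "s \<noteq> 0 \<or> t \<noteq> 0"
  shows "tangency_point (dual_conic (pen s t)) e = point_of (pen s t *v normal e)"
  by (intro tangency_point_dual pencil_symmetric pencil_edge_vanishes pencil_edge_nonzero assms)

lemma dual_conic_pencil:
  assumes "t \<noteq> 0"
  shows "dual_conic (pen s t) = inscribed_conic Q (s / t)"
  using dual_conic_scaleR[OF assms, of "pen (s / t) 1"] assms by (simp flip: pencil_scaleR)

lemma tangency_point_inscribed_eq_iff:
  assumes "e \<in> edge_lines Q"
  shows "tangency_point (inscribed_conic Q c) e = tangency_point (inscribed_conic Q d) e \<longleftrightarrow> c = d"
proof -
  obtain x e' y where x: "quad_lines e x e' y" "vertices (Quad e x e' y) = vertices Q"
      "edge_lines (Quad e x e' y) = edge_lines Q"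
      "\<forall>s t. pencil (normal e) (normal x) (normal e') (normal y) s t = pen s t"
    by (rule edge_as_first[OF assms])
  interpret E: quad_lines e x e' y by (rule x)
  have nz: "bracket (normal e) (normal e') (normal y) \<noteq> 0"
      "bracket (normal e) (normal e') (normal x) \<noteq> 0"
    using E.nz(3) E.nz_sym(1) .
  show ?thesis
    unfolding inscribed_conic.simps tangency_point_pencil[OF assms disjI2[OF one_neq_zero]]
      E.first_edge_mult[unfolded x(4)[rule_format]]
    by (subst point_of_combination_eq_iff[OF E.first_edges_cross_nonzero]) (simp_all add: nz)
qed

lemma tangency_point_not_vertex:
  assumes "e \<in> edge_lines Q" "c \<noteq> 0"
  shows "tangency_point (inscribed_conic Q c) e \<notin> vertices Q"
    and "on_line (tangency_point (inscribed_conic Q c) e) e"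
proof -
  obtain x e' y where x: "quad_lines e x e' y" "vertices (Quad e x e' y) = vertices Q"
      "edge_lines (Quad e x e' y) = edge_lines Q"
      "\<forall>s t. pencil (normal e) (normal x) (normal e') (normal y) s t = pen s t"
    by (rule edge_as_first[OF assms(1)])
  interpret E: quad_lines e x e' y by (rule x)
  show "tangency_point (inscribed_conic Q c) e \<notin> vertices Q"
    unfolding inscribed_conic.simps tangency_point_pencil[OF assms(1) disjI2[OF one_neq_zero]]
      E.first_edge_mult[unfolded x(4)[rule_format]] x(2)[symmetric]
    using E.nz(3) E.nz_sym(1) assms(2) by (intro E.combination_not_vertex) simp_all
  show "on_line (tangency_point (inscribed_conic Q c) e) e"
    unfolding inscribed_conic.simps tangency_point_pencil[OF assms(1) disjI2[OF one_neq_zero]]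
      on_line_point_of[OF pencil_edge_nonzero[OF assms(1) disjI2[OF one_neq_zero]]]
    using pencil_edge_vanishes[OF assms(1)] unfolding vanishes_def .
qed

text \<open>A point of the edge-line is a combination of the two vertices, and both coefficients are
  nonzero when it is not a vertex. Their quotient determines the parameter.\<close>

lemma tangency_point_surj:
  assumes e: "e \<in> edge_lines Q" and p: "on_line p e" "p \<notin> vertices Q"
  obtains c where "c \<noteq> 0" "p = tangency_point (inscribed_conic Q c) e"
proof -
  obtain x e' y where x: "quad_lines e x e' y" "vertices (Quad e x e' y) = vertices Q"
      "edge_lines (Quad e x e' y) = edge_lines Q"
      "\<forall>s t. pencil (normal e) (normal x) (normal e') (normal y) s t = pen s t"
    by (rule edge_as_first[OF e])
  interpret E: quad_lines e x e' y by (rule x)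
  obtain v where v: "v \<noteq> 0" "p = point_of v"
    by (rule point_of_cases)
  have ve: "v \<bullet> normal e = 0"
    using p v by (simp add: on_line_point_of inner_commute)
  have vx: "v \<bullet> normal x \<noteq> 0"
  proof
    assume "v \<bullet> normal x = 0"
    then have "meet e x = p"
      using E.edges_distinct v p by (intro meet_eqI) (simp_all add: on_line_point_of inner_commute)
    then show False
      using p x(2) by auto
  qed
  have vy: "v \<bullet> normal y \<noteq> 0"
  proof
    assume "v \<bullet> normal y = 0"
    then have "meet e y = p"
      using E.edges_distinct v p by (intro meet_eqI) (simp_all add: on_line_point_of inner_commute)
    then show False
      using p x(2) by auto
  qed
  define w where "w = (v \<bullet> normal y) *\<^sub>R (normal e \<times> normal x) +
      (- (v \<bullet> normal x)) *\<^sub>R (normal e \<times> normal y)"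
  have w: "bracket (normal e) (normal x) (normal y) *\<^sub>R v = w"
    unfolding bracket_cramer w_def using ve cross_skew[of "normal y" "normal e"] by simp
  then have "point_of v = point_of w"
    using v(1) E.nz(2) by (subst point_of_eq_iff) (auto simp: cross_mult_right simp flip: w)
  \<comment> \<open>the quotient of the weights in \<open>w\<close>, corrected by the factors in \<open>pencil_edge\<close>\<close>
  define c where "c = - (bracket (normal e) (normal e') (normal x) * (v \<bullet> normal y)) /
    (bracket (normal e) (normal e') (normal y) * (v \<bullet> normal x))"
  have "c \<noteq> 0"
    using vx vy E.nz E.nz_sym by (simp add: c_def)
  moreover have "p = tangency_point (inscribed_conic Q c) e"
    unfolding inscribed_conic.simps tangency_point_pencil[OF e disjI2[OF one_neq_zero]]
      E.first_edge_mult[unfolded x(4)[rule_format]] v(2) \<open>point_of v = point_of w\<close> w_def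
    using E.nz(3) E.nz_sym(1) vx vy
    by (subst point_of_combination_eq_iff[OF E.first_edges_cross_nonzero]) (simp_all add: c_def)
  ultimately show thesis
    by (rule that)
qed

lemma opposite_edges_line_space:
  "line_space (opposite_edges_line Q) =
    {v. ((normal a \<times> normal a') \<times> (normal b \<times> normal b')) \<bullet> v = 0}"
  unfolding opposite_edges_line.simps on_line_meet(3)[OF edges_distinct(5)] on_line_meet(3)[OF
      edges_distinct(6)]
  by (rule line_space_join[OF cross_edges_nonzero(5,6) opposite_edges_cross_nonzero])

lemma double_line_iff: "is_double_line C (opposite_edges_line Q) \<longleftrightarrow> C = inscribed_conic Q (- 1)"
proof -
  have "dual_conic (point_pair (normal a \<times> normal a') (normal b \<times> normal b')) =
      inscribed_conic Q (- 1)"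
    using dual_conic_pencil[of "- 1" 1] pencil_double_line[of "normal a" "normal b" "normal a'"
        "normal b'"]
    by simp
  then show ?thesis
    using is_double_line_iff[OF opposite_edges_cross_nonzero opposite_edges_line_space] by simp
qed

text \<open>A non-degenerate member of the pencil is inscribed, the parameter \<open>- 1\<close> is the double line,
  and the remaining degenerate members are excluded by \<open>c \<noteq> 0\<close>.\<close>

lemma inscribed_iff: "inscribed C Q \<longleftrightarrow> (\<exists>c. c \<noteq> 0 \<and> C = inscribed_conic Q c)"
proof
  assume "inscribed C Q"
  then consider "nondegenerate C" "\<forall>e\<in>edge_lines Q. tangent C e"
    | "is_double_line C (opposite_edges_line Q)"
    unfolding inscribed_def tangent_def by blast
  then show "\<exists>c. c \<noteq> 0 \<and> C = inscribed_conic Q c"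
  proof cases
    case 1
    then obtain B where B: "transpose B = B" "det B \<noteq> 0" "C = dual_conic B"
      using nondegenerate_cases by blast
    have van: "vanishes B (normal a)" "vanishes B (normal b)" "vanishes B (normal a')"
        "vanishes B (normal b')"
      using 1(2) unfolding B(3) tangent_dual_iff[OF B(1,2)] by simp_all
    obtain s t where st: "B = pen s t"
      by (rule in_pencil[OF B(1) van])
    then have "s \<noteq> 0" and "t \<noteq> 0"
      using B(2) by (simp_all add: det_pencil_eq_0_iff)
    moreover have "C = inscribed_conic Q (s / t)"
      unfolding B(3) st using \<open>t \<noteq> 0\<close> by (rule dual_conic_pencil)
    ultimately have "s / t \<noteq> 0" "C = inscribed_conic Q (s / t)"
      by simp_all
    then show ?thesis
      by blast
  next
    case 2
    then have "C = inscribed_conic Q (- 1)"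
      by (simp only: double_line_iff)
    then show ?thesis
      by (intro exI[of _ "- 1"]) simp
  qed
next
  assume "\<exists>c. c \<noteq> 0 \<and> C = inscribed_conic Q c"
  then obtain c where c: "c \<noteq> 0" "C = inscribed_conic Q c"
    by blast
  show "inscribed C Q"
  proof (cases "c = - 1")
    case True
    then show ?thesis
      using c double_line_iff by (simp add: inscribed_def)
  next
    case False
    then have "det (pen c 1) \<noteq> 0"
      using c det_pencil_eq_0_iff[of c 1] by auto
    then have "nondegenerate C"
      using nondegenerate_dual_iff[OF pencil_symmetric det_nonzero_cof] c by simp
    moreover have "\<exists>p. tangent_at C e p \<and> p \<notin> vertices Q" if e: "e \<in> edge_lines Q" for e
      using tangent_at_dual[OF pencil_symmetric pencil_edge_vanishes[OF e] pencil_edge_nonzero[OF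
          e], of c 1]
        tangency_point_not_vertex(1)[OF e c(1)] tangency_point_pencil[OF e, of c 1] c(2)
      by auto
    ultimately show ?thesis
      by (simp add: inscribed_def)
  qed
qed

end

text \<open>Both points of contact are combinations of the two vertices on the common edge-line \<open>y\<close>. The
  parameter weighs one vertex in the first quadrilateral and the other vertex in the second one,
  which is why the product of the parameters occurs.\<close>

lemma touching_iff:
  assumes "quad_lines x u y v" "quad_lines y u z v" "c \<noteq> 0" "d \<noteq> 0"
  shows "tangency_point (inscribed_conic (Quad x u y v) c) y =
      tangency_point (inscribed_conic (Quad y u z v) d) y \<longleftrightarrow>
    c * d * (bracket (normal y) (normal x) (normal u) * bracket (normal y) (normal z) (normal v)) =
      bracket (normal y) (normal x) (normal v) * bracket (normal y) (normal z) (normal u)"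
proof -
  interpret F: quad_lines x u y v by (rule assms)
  interpret G: quad_lines y u z v by (rule assms)
  have 1: "tangency_point (inscribed_conic (Quad x u y v) c) y =
     point_of ((1 * bracket (normal y) (normal x) (normal v)) *\<^sub>R (normal y \<times> normal u) +
      (c * bracket (normal y) (normal x) (normal u)) *\<^sub>R (normal y \<times> normal v))"
    by (simp add: F.tangency_point_pencil pencil_edge(2) add.commute)
  have 2: "tangency_point (inscribed_conic (Quad y u z v) d) y =
     point_of ((d * bracket (normal y) (normal z) (normal v)) *\<^sub>R (normal y \<times> normal u) +
      (1 * bracket (normal y) (normal z) (normal u)) *\<^sub>R (normal y \<times> normal v))"
    by (simp add: G.tangency_point_pencil pencil_edge(1))
  have "bracket (normal y) (normal x) (normal v) \<noteq> 0" "bracket (normal y) (normal z) (normal u) \<noteq> 0"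
    using F.nz_sym(4) G.nz_sym(1) .
  then show ?thesis
    unfolding 1 2 by (subst point_of_combination_eq_iff[OF G.first_edges_cross_nonzero]) (auto
        simp: mult_ac)
qed

section \<open>Five lines\<close>

text \<open>Five normal vectors of which no three are dependent.\<close>

locale five_lines = quadrilateral +
  fixes e
  assumes e: "bracket a b e \<noteq> 0" "bracket a b' e \<noteq> 0" "bracket a' b e \<noteq> 0" "bracket a' b' e \<noteq> 0"
      "bracket a a' e \<noteq> 0" "bracket b b' e \<noteq> 0"
begin

text \<open>Vanishing on the fifth line fixes the ratio of the two parameters of the pencil.\<close>

lemma vanishing_unique:
  assumes D: "transpose D = D" "vanishes D a" "vanishes D b" "vanishes D a'" "vanishes D b'"
      "vanishes D e"
  obtains c where "D = c *\<^sub>R pencil a b a' b'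
      (bracket a b' e * bracket a' b e) (- (bracket a b e * bracket a' b' e))"
proof -
  obtain s t where st: "D = pencil a b a' b' s t"
    using in_pencil D by blast
  define S where "S = bracket a b' e * bracket a' b e"
  define T where "T = bracket a b e * bracket a' b' e"
  have "s * T + t * S = 0"
    using D(6) unfolding st vanishes_def pencil_quadratic by (simp add: S_def T_def mult.assoc)
  moreover have "S \<noteq> 0" "T \<noteq> 0"
    using e by (simp_all add: S_def T_def)
  ultimately have "s = (s / S) * S" "t = (s / S) * (- T)"
    by (simp_all add: field_simps)
  then have "D = (s / S) *\<^sub>R pencil a b a' b' S (- T)"
    unfolding st by (metis pencil_scaleR)
  then show thesis
    unfolding S_def T_def by (rule that)
qed

text \<open>The degenerate members of the pencil are pairs of points, and one of the two points would
  lie on three of the five lines.\<close>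

lemma det_vanishing_nonzero:
  assumes D: "transpose D = D" "vanishes D a" "vanishes D b" "vanishes D a'" "vanishes D b'"
      "vanishes D e"
    and "D \<noteq> 0"
  shows "det D \<noteq> 0"
proof -
  define S where "S = bracket a b' e * bracket a' b e"
  define T where "T = bracket a b e * bracket a' b' e"
  obtain c where c: "D = c *\<^sub>R pencil a b a' b' S (- T)"
    using vanishing_unique[OF D] unfolding S_def T_def by blast
  have "T - S = bracket a a' e * bracket b b' e"
    using bracket_pluecker[of e a a' b b'] by (simp add: S_def T_def bracket_rotate algebra_simps)
  then have "S + - T \<noteq> 0"
    using e(5,6) by auto
  moreover have "S \<noteq> 0" "T \<noteq> 0"
    using e by (simp_all add: S_def T_def)
  ultimately have "det (pencil a b a' b' S (- T)) \<noteq> 0"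
    using det_pencil_eq_0_iff[of S "- T"] by simp
  moreover have "c \<noteq> 0"
    using c \<open>D \<noteq> 0\<close> by auto
  ultimately show ?thesis
    by (simp add: c det_scaleR)
qed

lemma vanishing_transfer:
  assumes "transpose D = D" "vanishes D a" "vanishes D b" "vanishes D a'" "vanishes D b'"
      "vanishes D e"
    and "transpose D' = D'" "vanishes D' a" "vanishes D' b" "vanishes D' a'" "vanishes D' b'"
        "vanishes D' e"
    and "D \<noteq> 0" "vanishes D x"
  shows "vanishes D' x"
proof -
  obtain c d where c: "D = c *\<^sub>R pencil a b a' b' (bracket a b' e *
      bracket a' b e) (- (bracket a b e * bracket a' b' e))"
    and d: "D' = d *\<^sub>R pencil a b a' b' (bracket a b' e * bracket a' b e) (- (bracket a b e *
        bracket a' b' e))"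
    using vanishing_unique[OF assms(1-6)] vanishing_unique[OF assms(7-12)] by metis
  have "c \<noteq> 0"
    using c assms(13) by auto
  then show ?thesis
    using assms(14) unfolding c d by (simp add: vanishes_def scaleR_quadratic)
qed

end

text \<open>The hypothesis says that the lines \<open>x, z, u, w\<close> cut \<open>y\<close> and \<open>v\<close> in the same cross ratio: the
  form of their pencil that vanishes on \<open>y\<close> also vanishes on \<open>v\<close> (the dual of the theorem of
  Chasles and Steiner).\<close>

lemma six_lines:
  assumes "quadrilateral x w z u"
    and y: "bracket x u y \<noteq> 0" "bracket z w y \<noteq> 0"
    and eq: "bracket y z u * bracket y x w * (bracket v u x * bracket v w z) =
        bracket v w x * bracket v u z * (bracket y x u * bracket y z w)"
  obtains D where "transpose D = D" "D \<noteq> 0" "vanishes D x" "vanishes D y" "vanishes D z"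
    "vanishes D u" "vanishes D v" "vanishes D w"
proof -
  interpret quadrilateral x w z u by (rule assms)
  define s where "s = bracket x u y * bracket z w y"
  define t where "t = - (bracket x w y * bracket z u y)"
  define D where "D = pencil x w z u s t"
  have "s \<noteq> 0"
    using y by (simp add: s_def)
  then have "D *v x \<noteq> 0"
    unfolding D_def by (intro pencil_nonzero_on_edge) simp
  then have "D \<noteq> 0"
    by auto
  moreover have "vanishes D y"
    by (simp add: D_def vanishes_def pencil_quadratic s_def t_def)
  moreover have "vanishes D v"
  proof -
    have r: "bracket y z u = bracket z u y" "bracket y x w = bracket x w y"
        "bracket y x u = bracket x u y" "bracket y z w = bracket z w y"
        "bracket v u x = - bracket x u v" "bracket v w z = - bracket z w v"
            "bracket v w x = - bracket x w v" "bracket v u z = - bracket z u v"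
      by (simp_all add: bracket_def cross3_simps)
    show ?thesis
      using eq unfolding r by (simp add: D_def vanishes_def pencil_quadratic s_def t_def
          algebra_simps)
  qed
  moreover have "transpose D = D" "vanishes D x" "vanishes D z" "vanishes D u" "vanishes D w"
    unfolding D_def by (simp_all add: pencil_symmetric pencil_vanishes)
  ultimately show thesis
    using that by blast
qed

section \<open>Conics with prescribed chords of contact\<close>

text \<open>Here \<open>p\<close> and \<open>r\<close> are the intersection points of the two pairs of opposite edge-lines. The
  multiple of \<open>D\<close> is chosen so that the points of contact on lines through \<open>r\<close> lie on the polar
  \<open>cof D *v p\<close> of \<open>p\<close>, see \<open>contact_dual_polar\<close>; by symmetry those on lines through \<open>p\<close> lie on the
  polar of \<open>r\<close>.\<close>

definition contact_dual :: "real^3^3 \<Rightarrow> real^3 \<Rightarrow> real^3 \<Rightarrow> real^3^3" where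
  "contact_dual D p r = (p \<bullet> (cof D *v r)) *\<^sub>R D + (- det D) *\<^sub>R point_pair p r"

lemma contact_dual_symmetric: "transpose D = D \<Longrightarrow>
    transpose (contact_dual D p r) = contact_dual D p r"
  unfolding contact_dual_def transpose_add_scale point_pair_symmetric by simp

lemma contact_dual_commute: "transpose D = D \<Longrightarrow> contact_dual D r p = contact_dual D p r"
  unfolding contact_dual_def using symmetric_inner[OF cof_symmetric, of D r p]
      point_pair_commute[of r p] by simp

lemma contact_dual_minus: "contact_dual D p (- r) = - contact_dual D p r"
proof -
  have "point_pair p (- r) = - point_pair p r"
    by (simp add: point_pair_def vec_eq_iff)
  moreover have "cof D *v (- r) = - (cof D *v r)"
    using matrix_vector_mult_scaleR[of "cof D" "- 1" r] by simp
  ultimately show ?thesis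
    by (simp add: contact_dual_def)
qed

lemma contact_dual_vanishes:
  assumes "vanishes D e" "e \<bullet> p = 0 \<or> e \<bullet> r = 0"
  shows "vanishes (contact_dual D p r) e"
  using assms unfolding vanishes_def contact_dual_def add_scale_mult point_pair_mult
  by (auto simp: inner_add_right inner_diff_right inner_commute)

lemma contact_dual_polar:
  assumes "transpose D = D" "e \<bullet> r = 0"
  shows "(contact_dual D p r *v e) \<bullet> (cof D *v p) = 0"
proof -
  have "r \<bullet> (cof D *v p) = p \<bullet> (cof D *v r)"
    using symmetric_inner[OF cof_symmetric[OF assms(1)]] .
  then show ?thesis
    using assms(2) unfolding contact_dual_def add_scale_mult point_pair_mult
    by (simp add: inner_add_left inner_diff_left mult_inner_cof_mult inner_commute[of r e]
        inner_commute[of p e])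
qed

text \<open>A product of two brackets is a Gram determinant, so everything is expressed by the values of
  \<open>D\<close> on pairs of lines, and all terms but one cancel. The remaining product shows that the two
  pairs of opposite vertices are avoided.\<close>

lemma contact_dual_value:
  assumes D: "transpose D = D" "vanishes D a" "vanishes D b'"
  shows "b' \<bullet> (contact_dual D (a \<times> a') (b \<times> b') *v a) =
    - ((a \<bullet> (D *v b')) * (b \<bullet> (D *v b')) * (a \<bullet> (D *v a')))"
proof -
  have pr: "(a \<times> a') \<bullet> (cof D *v (b \<times> b')) =
      (a \<bullet> (D *v b)) * (a' \<bullet> (D *v b')) - (a \<bullet> (D *v b')) * (a' \<bullet> (D *v b))"
    unfolding cof_mult_cross dot_cross ..
  have dd: "det D * bracket b' a a' * bracket a b b' =
      bracket (D *v b') (D *v a) (D *v a') * bracket a b b'"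
    by (simp add: bracket_mult)
  note s = symmetric_inner[OF D(1)]
  have "b' \<bullet> (contact_dual D (a \<times> a') (b \<times> b') *v a) =
      ((a \<times> a') \<bullet> (cof D *v (b \<times> b'))) * (b' \<bullet> (D *v a)) - det D * bracket b' a a' * bracket a b b'"
    unfolding contact_dual_def add_scale_mult point_pair_mult
    by (simp add: inner_add_right inner_diff_right cross_inner_eq_bracket(1)[of b] bracket_def[of
        b'] bracket_rotate)
      (simp add: cross_inner_eq_bracket bracket_rotate)
  then show ?thesis
    unfolding dd bracket_mult_bracket pr
    using D(2,3) s[of b' a] s[of b' b] s[of a' a] s[of b a] s[of b' a'] s[of b a']
    by (simp add: vanishes_def inner_commute[of "D *v _"] algebra_simps)
qed

context quadrilateral
begin

text \<open>Distinct tangent lines of a non-degenerate conic are not conjugate.\<close>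

lemma isotropic_products_nonzero:
  assumes D: "transpose D = D" "vanishes D a" "vanishes D b" "vanishes D a'" "vanishes D b'"
    and "det D \<noteq> 0"
  shows "a \<bullet> (D *v b) \<noteq> 0" "a \<bullet> (D *v b') \<noteq> 0" "b \<bullet> (D *v b') \<noteq> 0" "a \<bullet> (D *v a') \<noteq> 0"
  using gram_det_isotropic[OF D(1,2,3,5)] gram_det_isotropic[OF D(1,2,4,5)] nz(2,3) assms(6)
  by auto

text \<open>With \<open>s = 0\<close> the point of contact on \<open>a\<close> would be a vertex on \<open>b'\<close>, with \<open>t = 0\<close> a vertex on
  \<open>b\<close>; both contradict \<open>contact_dual_value\<close>.\<close>

lemma contact_dual_in_pencil:
  assumes D: "transpose D = D" "vanishes D a" "vanishes D b" "vanishes D a'" "vanishes D b'"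
    and det: "det D \<noteq> 0"
  obtains s t where "s \<noteq> 0" "t \<noteq> 0" "contact_dual D (a \<times> a') (b \<times> b') = pencil a b a' b' s t"
proof -
  let ?B = "contact_dual D (a \<times> a') (b \<times> b')"
  have "vanishes ?B a" "vanishes ?B b" "vanishes ?B a'" "vanishes ?B b'"
    using D by (auto intro!: contact_dual_vanishes simp: dot_cross_self)
  then obtain s t where st: "?B = pencil a b a' b' s t"
    using in_pencil[OF contact_dual_symmetric[OF D(1)]] by blast
  have s: "b' \<bullet> (?B *v a) \<noteq> 0"
    unfolding contact_dual_value[OF D(1,2,5)] using isotropic_products_nonzero[OF D det] by simp
  \<comment> \<open>exchanging \<open>b\<close> and \<open>b'\<close> reduces the second value to the first one\<close>
  have "b \<times> b' = - (b' \<times> b)"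
    by (rule cross_skew)
  then have "?B = - contact_dual D (a \<times> a') (b' \<times> b)"
    by (simp only: contact_dual_minus)
  then have "?B *v a = - (contact_dual D (a \<times> a') (b' \<times> b) *v a)"
    using scaleR_matrix_vector_assoc[of "- 1" "contact_dual D (a \<times> a') (b' \<times> b)" a] by simp
  then have t: "b \<bullet> (?B *v a) \<noteq> 0"
    using contact_dual_value[OF D(1,2,3), of a' b'] isotropic_products_nonzero[OF D det]
      symmetric_inner[OF D(1), of b' b] by simp
  have "s \<noteq> 0"
    using s unfolding st pencil_edge by (auto simp: inner_add_right dot_cross_self)
  moreover have "t \<noteq> 0"
    using t unfolding st pencil_edge by (auto simp: inner_add_right dot_cross_self)
  ultimately show thesis
    using st that by blast
qed

text \<open>If \<open>b\<close> were the polar of \<open>a \<times> a'\<close>, its point of contact \<open>a \<times> a'\<close> would lie on \<open>a\<close>; but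
  distinct tangent lines are not conjugate.\<close>

lemma polar_not_edge:
  assumes D: "transpose D = D" "vanishes D a" "vanishes D b" "vanishes D a'" "vanishes D b'"
    and det: "det D \<noteq> 0"
  shows "b \<times> (cof D *v (a \<times> a')) \<noteq> 0"
proof
  have "det (cof D) \<noteq> 0"
    using det by (simp add: det_cof)
  then have "cof D *v (a \<times> a') \<noteq> 0"
    using det_nonzero_mult[OF cof_symmetric[OF D(1)]] cross_edges_nonzero(5) by blast
  moreover assume "b \<times> (cof D *v (a \<times> a')) = 0"
  ultimately obtain c where "b = c *\<^sub>R (cof D *v (a \<times> a'))"
    using parallelE by blast
  then have "D *v b = (c * det D) *\<^sub>R (a \<times> a')"
    using cof_mult_mult(2)[OF D(1), of "a \<times> a'"] by (simp add: matrix_vector_mult_scaleR)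
  then show False
    using isotropic_products_nonzero(1)[OF D det] by (simp add: dot_cross_self)
qed

text \<open>The pole, with respect to one pair of opposite vertices, of the line joining the
  intersection points of opposite edge-lines. A pole with respect to a pair of points lies on the
  line joining them, which here is a diagonal.\<close>

definition diagonal_point :: "real^3" where
  "diagonal_point = point_pair (a \<times> b) (a' \<times> b') *v ((a \<times> a') \<times> (b \<times> b'))"

text \<open>The pair of intersection points of opposite edge-lines is the difference of the two pairs of
  vertices and kills the line joining its two points. So both pairs give the same pole, which is
  therefore on both diagonals.\<close>

lemma diagonal_point_other: "diagonal_point = point_pair (a \<times> b') (a' \<times> b) *v ((a \<times> a') \<times> (b \<times> b'))"
proof -
  have "pencil a b a' b' 1 (- 1) *v ((a \<times> a') \<times> (b \<times> b')) = 0"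
    unfolding pencil_double_line by (simp add: point_pair_mult dot_cross_self)
  then show ?thesis
    unfolding pencil_def add_scale_mult by (simp add: diagonal_point_def)
qed

lemma pencil_mult_opposite:
  "pencil a b a' b' s t *v ((a \<times> a') \<times> (b \<times> b')) = (s + t) *\<^sub>R diagonal_point"
  unfolding pencil_def add_scale_mult diagonal_point_other[symmetric] diagonal_point_def[symmetric]
  by (simp add: scaleR_add_left)

lemma opposite_edges_inner': "(a' \<times> b') \<bullet> ((a \<times> a') \<times> (b \<times> b')) = bracket a a' b' * bracket a' b' b"
  by (simp add: cross_cross_bracket inner_diff_right cross_inner_eq_bracket)

lemma inner_diagonal_point:
  "g \<bullet> diagonal_point = bracket a a' b' * bracket a' b' b * bracket a b g - bracket a a' b *
      bracket a b b' * bracket a' b' g"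
  unfolding diagonal_point_def point_pair_mult inner_add_right opposite_edges_inner
      opposite_edges_inner'
  by (simp add: cross_inner_eq_bracket)

lemma diagonal_point_nonzero: "diagonal_point \<noteq> 0"
proof
  assume "diagonal_point = 0"
  then have "a \<bullet> diagonal_point = 0"
    by simp
  then show False
    using nz nz_sym bracket_rotate[of a' b' a] unfolding inner_diagonal_point by auto
qed

text \<open>The diagonal point is also the \<open>D\<close>-pole of the line joining \<open>a \<times> a'\<close> and \<open>b \<times> b'\<close>, hence it
  is on the \<open>D\<close>-polars of these two points.\<close>

lemma diagonal_point_polar:
  assumes D: "transpose D = D" "vanishes D a" "vanishes D b" "vanishes D a'" "vanishes D b'"
    and det: "det D \<noteq> 0"
  shows "(cof D *v (a \<times> a')) \<bullet> diagonal_point = 0" "(cof D *v (b \<times> b')) \<bullet> diagonal_point = 0"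
proof -
  obtain s t where st: "D = pencil a b a' b' s t"
    using in_pencil[OF D] .
  then have "s + t \<noteq> 0"
    using det det_pencil_eq_0_iff by simp
  have "(s + t) * (diagonal_point \<bullet> (cof D *v p)) = det D * (((a \<times> a') \<times> (b \<times> b')) \<bullet> p)" for p
    using mult_inner_cof_mult[of D "(a \<times> a') \<times> (b \<times> b')" p] pencil_mult_opposite[of s t]
    unfolding st[symmetric] by simp
  from this[of "a \<times> a'"] this[of "b \<times> b'"] \<open>s + t \<noteq> 0\<close>
  show "(cof D *v (a \<times> a')) \<bullet> diagonal_point = 0" "(cof D *v (b \<times> b')) \<bullet> diagonal_point = 0"
    by (simp_all add: dot_cross_self inner_commute)
qed

text \<open>For \<open>g\<close> through the diagonal point the quotient of \<open>bracket a x g * bracket a' x g\<close> by the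
  square of \<open>bracket a a' x\<close> is the same for \<open>x = b\<close> and \<open>x = b'\<close>: a rectangle area in the affine
  picture. The identity combines the two bracket relations with base \<open>a\<close> and with base \<open>a'\<close>.\<close>

lemma diagonal_point_identity:
  "bracket a a' g * (g \<bullet> diagonal_point) =
    bracket a b' g * bracket a' b' g * (bracket a a' b)\<^sup>2 -
    bracket a b g * bracket a' b g * (bracket a a' b')\<^sup>2"
proof -
  define p where "p = bracket a a' b"
  define p' where "p' = bracket a a' b'"
  define f where "f = bracket a a' g"
  define \<alpha> where "\<alpha> = bracket a b g"
  define \<alpha>' where "\<alpha>' = bracket a b' g"
  define \<beta> where "\<beta> = bracket a' b g"
  define \<beta>' where "\<beta>' = bracket a' b' g"
  define c where "c = bracket a b b'"
  define d where "d = bracket a' b b'"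
  have 1: "p * \<alpha>' - p' * \<alpha> + f * c = 0"
    using bracket_pluecker[of a a' b b' g] by (simp add: p_def p'_def f_def \<alpha>_def \<alpha>'_def c_def)
  have 2: "- p * \<beta>' + p' * \<beta> - f * d = 0"
    using bracket_pluecker[of a' a b b' g] bracket_swap(1)[of a' a b] bracket_swap(1)[of a' a b']
        bracket_swap(1)[of a' a g]
    by (simp add: p_def p'_def f_def \<beta>_def \<beta>'_def d_def)
  have "g \<bullet> diagonal_point = - p' * d * \<alpha> - p * c * \<beta>'"
    unfolding inner_diagonal_point
    using bracket_swap(2)[of a' b' b] by (simp add: p_def p'_def \<alpha>_def \<beta>'_def c_def d_def)
  moreover have "f * (- p' * d * \<alpha> - p * c * \<beta>') = \<alpha>' * \<beta>' * p\<^sup>2 - \<alpha> * \<beta> * p'\<^sup>2"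
    using 1 2 by algebra
  ultimately show ?thesis
    by (simp add: p_def p'_def f_def \<alpha>_def \<alpha>'_def \<beta>_def \<beta>'_def)
qed

end

context quad_lines
begin

lemma diagonals_meet_eq: "diagonals_meet Q = point_of diagonal_point"
proof -
  note n = normal(1)
  have c1: "(normal a \<times> normal b) \<times> (normal a' \<times> normal b') \<noteq> 0"
    and c2: "(normal a \<times> normal b') \<times> (normal a' \<times> normal b) \<noteq> 0"
    and ne: "((normal a \<times> normal b) \<times> (normal a' \<times> normal b')) \<bullet> (normal a \<times> normal b') \<noteq> 0"
  proof -
    have 1: "((normal a \<times> normal b) \<times> (normal a' \<times> normal b')) \<bullet> (normal a \<times> normal b') =
        bracket (normal a) (normal b) (normal b') * bracket (normal a) (normal b') (normal a')"
      unfolding cross_cross_bracket inner_diff_left inner_scaleR_left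
      by (simp add: cross_inner_eq_bracket bracket_rotate)
    have 2: "((normal a \<times> normal b') \<times> (normal a' \<times> normal b)) \<bullet> (normal a \<times> normal b) =
        bracket (normal a) (normal b') (normal b) * bracket (normal a) (normal b) (normal a')"
      unfolding cross_cross_bracket inner_diff_left inner_scaleR_left
      by (simp add: cross_inner_eq_bracket bracket_rotate)
    have "bracket (normal a) (normal b') (normal a') \<noteq> 0"
        "bracket (normal a) (normal b') (normal b) \<noteq> 0"
      using nz bracket_swap(2)[of "normal a" "normal a'"
          "normal b'"] bracket_swap(2)[of "normal a" "normal b" "normal b'"]
      by simp_all
    with 1 2 nz show "(normal a \<times> normal b) \<times> (normal a' \<times> normal b') \<noteq> 0"
      "(normal a \<times> normal b') \<times> (normal a' \<times> normal b) \<noteq> 0"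
      "((normal a \<times> normal b) \<times> (normal a' \<times> normal b')) \<bullet> (normal a \<times> normal b') \<noteq> 0"
      by auto
  qed
  note ls1 = line_space_join[OF cross_edges_nonzero(1,3) c1]
  note ls2 = line_space_join[OF cross_edges_nonzero(2,4) c2]
  let ?j1 = "join (point_of (normal a \<times> normal b)) (point_of (normal a' \<times> normal b'))"
  let ?j2 = "join (point_of (normal a \<times> normal b')) (point_of (normal a' \<times> normal b))"
  have "on_line (point_of (normal a \<times> normal b')) ?j2"
      "\<not> on_line (point_of (normal a \<times> normal b')) ?j1"
    using on_line_iff[OF cross_edges_nonzero(2) ls1] on_line_iff[OF cross_edges_nonzero(2) ls2] ne
    by (simp_all add: dot_cross_self)
  then have "?j1 \<noteq> ?j2"
    by metis
  moreover have "on_line (point_of diagonal_point) ?j1"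
    unfolding on_line_iff[OF diagonal_point_nonzero ls1]
    by (simp add: diagonal_point_def point_pair_mult inner_add_right dot_cross_self)
  moreover have "on_line (point_of diagonal_point) ?j2"
    unfolding on_line_iff[OF diagonal_point_nonzero ls2]
    by (simp add: diagonal_point_other point_pair_mult inner_add_right dot_cross_self)
  ultimately have "meet ?j1 ?j2 = point_of diagonal_point"
    by (rule meet_eqI)
  then show ?thesis
    using edges_distinct by (simp add: on_line_meet(3))
qed

end

section \<open>Two lines crossed by a family\<close>

text \<open>In the notation of the proof, the quotient \<open>\<alpha> j * \<beta> j / (p j)\<^sup>2\<close> does not depend on \<open>j\<close>
  (\<open>diagonal_point_identity\<close>); with its value \<open>c\<close> the equation \<open>\<alpha> * \<beta> = c * p\<^sup>2\<close> is the wanted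
  dual conic. It is the zero form only if \<open>g\<close> passes through \<open>a \<times> a'\<close> (the centre of the hyperbola
  is at infinity). In this case the lines \<open>l 0, l 1, l 2\<close> would be concurrent.\<close>

lemma strip_conic:
  fixes a a' g :: "real^3" and l :: "nat \<Rightarrow> real^3"
  assumes quads: "\<And>j. j \<in> {1..n} \<Longrightarrow> quadrilateral a (l (j - 1)) a' (l j)"
    and n: "n \<ge> 2" and l012: "bracket (l 0) (l 1) (l 2) \<noteq> 0" and g: "g \<noteq> 0"
    and diag: "\<And>j. j \<in> {1..n} \<Longrightarrow> g \<bullet> quadrilateral.diagonal_point a (l (j - 1)) a' (l j) = 0"
  obtains D where "transpose D = D" "D \<noteq> 0" "vanishes D a" "vanishes D a'"
    "\<And>j. j \<le> n \<Longrightarrow> vanishes D (l j)"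
proof -
  define p where "p j = bracket a a' (l j)" for j
  define \<alpha> where "\<alpha> j = bracket a (l j) g" for j
  define \<beta> where "\<beta> j = bracket a' (l j) g" for j
  define f where "f = bracket a a' g"
  interpret Q1: quadrilateral a "l 0" a' "l 1"
    using quads[of 1] n by simp
  interpret Q2: quadrilateral a "l 1" a' "l 2"
    using quads[of 2] n by (simp add: numeral_2_eq_2)
  have p: "p j \<noteq> 0" if "j \<le> n" for j
  proof (cases j)
    case 0
    then show ?thesis
      using Q1.nz_sym(1) by (simp add: p_def)
  next
    case (Suc i)
    then show ?thesis
      using quadrilateral.nz(3)[OF quads[of j]] that by (simp add: p_def)
  qed
  have step: "\<alpha> j * \<beta> j * (p (j - 1))\<^sup>2 = \<alpha> (j - 1) * \<beta> (j - 1) * (p j)\<^sup>2" if "j \<in> {1..n}" for j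
    using quadrilateral.diagonal_point_identity[OF quads[OF that], of g] diag[OF that]
    by (simp add: p_def \<alpha>_def \<beta>_def)
  define c where "c = \<alpha> 0 * \<beta> 0 / (p 0)\<^sup>2"
  have c: "\<alpha> j * \<beta> j = c * (p j)\<^sup>2" if "j \<le> n" for j
    using that
  proof (induction j)
    case 0
    then show ?case
      using p[of 0] by (simp add: c_def)
  next
    case (Suc j)
    then have "\<alpha> (Suc j) * \<beta> (Suc j) * (p j)\<^sup>2 = c * (p (Suc j))\<^sup>2 * (p j)\<^sup>2"
      using step[of "Suc j"] by (simp add: mult_ac)
    then show ?case
      using p[of j] Suc.prems by simp
  qed
  have "f \<noteq> 0"
  proof
    assume f: "f = 0"
    \<comment> \<open>a normal vector of the line through \<open>l 0 \<inter> l 1\<close>, \<open>l 1 \<inter> l 2\<close> and \<open>a \<inter> a'\<close>;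
      only \<open>l 1\<close> passes through the first two, but it misses the third\<close>
    define h where "h = \<alpha> 1 *\<^sub>R a' + \<beta> 1 *\<^sub>R a"
    have 1: "p 0 * \<alpha> 1 = p 1 * \<alpha> 0" "p 1 * \<beta> 2 = p 2 * \<beta> 1"
    proof -
      show "p 0 * \<alpha> 1 = p 1 * \<alpha> 0"
        using bracket_pluecker[of a a' "l 0" "l 1" g] f by (simp add: p_def \<alpha>_def f_def)
      show "p 1 * \<beta> 2 = p 2 * \<beta> 1"
        using bracket_pluecker[of a' a "l 1" "l 2" g] f bracket_swap(1)[of a' a "l 1"]
            bracket_swap(1)[of a' a "l 2"]
          bracket_swap(1)[of a' a g] by (simp add: p_def \<beta>_def f_def)
    qed
    have 2: "\<alpha> 0 * p 1 * bracket a' (l 0) (l 1) + \<beta> 1 * p 0 * bracket a (l 0) (l 1) = 0"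
      using diag[of 1] n Q1.inner_diagonal_point[of g] bracket_swap(2)[of a' "l 1" "l 0"]
      by (simp add: p_def \<alpha>_def \<beta>_def algebra_simps)
    have 3: "\<alpha> 1 * p 2 * bracket a' (l 1) (l 2) + \<beta> 2 * p 1 * bracket a (l 1) (l 2) = 0"
      using diag[of 2] n Q2.inner_diagonal_point[of g] bracket_swap(2)[of a' "l 2" "l 1"]
      by (simp add: p_def \<alpha>_def \<beta>_def algebra_simps numeral_2_eq_2)
    have "p 0 * (h \<bullet> (l 0 \<times> l 1)) = 0"
      unfolding h_def inner_add_left inner_scaleR_left unfolding bracket_def[symmetric]
          using 1(1) 2 by algebra
    moreover have "p 2 * (h \<bullet> (l 1 \<times> l 2)) = 0"
      unfolding h_def inner_add_left inner_scaleR_left unfolding bracket_def[symmetric]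
          using 1(2) 3 by algebra
    ultimately have h01: "h \<bullet> (l 0 \<times> l 1) = 0" "h \<bullet> (l 1 \<times> l 2) = 0"
      using p[of 0] p[of 2] n by auto
    have "(l 0 \<times> l 1) \<times> (l 1 \<times> l 2) = bracket (l 0) (l 1) (l 2) *\<^sub>R l 1"
      by (simp add: cross_cross_bracket)
    moreover have "l 1 \<noteq> 0"
      using l012 by (auto simp: bracket_def)
    ultimately obtain d where d: "h = d *\<^sub>R (bracket (l 0) (l 1) (l 2) *\<^sub>R l 1)"
      using parallel_cross[OF _ h01] l012 by (metis scaleR_eq_0_iff)
    have "h \<bullet> (a \<times> a') = 0"
      by (simp add: h_def inner_add_left dot_cross_self)
    then have "d * bracket (l 0) (l 1) (l 2) * p 1 = 0"
      unfolding d inner_scaleR_left by (simp add: p_def cross_inner_eq_bracket)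
    then have "h = 0"
      using d l012 p[of 1] n by simp
    then have "h \<times> a = 0" "h \<times> a' = 0"
      by simp_all
    then have "\<alpha> 1 = 0" "\<beta> 1 = 0"
      using Q1.cross_edges_nonzero(5) cross_skew[of a' a]
      by (simp_all add: h_def cross_add_left cross_mult_left)
    have "l 1 \<times> g = 0"
      by (rule orthogonal_to_basis_eq_0[of a a' "l 1"])
        (use p[of 1] n \<open>\<alpha> 1 = 0\<close> \<open>\<beta> 1 = 0\<close> in \<open>simp_all add: p_def \<alpha>_def \<beta>_def bracket_def
            inner_commute dot_cross_self\<close>)
    then have "g \<times> l 1 = 0"
      by (simp add: cross_skew[of g])
    then obtain x where "g = x *\<^sub>R l 1"
      using parallelE \<open>l 1 \<noteq> 0\<close> by blast
    then have "x * p 1 = 0"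
      using f by (simp add: f_def p_def bracket_def cross_mult_right)
    then show False
      using p[of 1] n g \<open>g = x *\<^sub>R l 1\<close> by simp
  qed
  \<comment> \<open>twice the form \<open>\<alpha> * \<beta> - c * p\<^sup>2\<close>; the factor \<open>1\<close> only brings it into the shape of
      \<open>add_scale_mult\<close>\<close>
  define D where "D = 1 *\<^sub>R point_pair (a \<times> g) (a' \<times> g) + (- c) *\<^sub>R point_pair (a \<times> a') (a \<times> a')"
  have D: "e \<bullet> (D *v e) = 2 * (bracket a e g * bracket a' e g - c * (bracket a a' e)\<^sup>2)" for e
    unfolding D_def add_scale_mult point_pair_mult inner_add_right inner_scaleR_right
        cross_inner_eq_bracket
    using bracket_swap(2)[of a g e] bracket_swap(2)[of a' g e]
    by (simp add: power2_eq_square algebra_simps)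
  have "a \<bullet> (D *v a') = - f\<^sup>2"
    unfolding D_def add_scale_mult point_pair_mult
    using bracket_swap(1)[of a a' g] bracket_swap(2)[of a a' g]
    by (simp add: inner_add_right cross_inner_eq_bracket bracket_rotate f_def power2_eq_square)
  then have "D \<noteq> 0"
    using \<open>f \<noteq> 0\<close> by auto
  moreover have "transpose D = D"
    unfolding D_def transpose_add_scale point_pair_symmetric ..
  moreover have "vanishes D a" "vanishes D a'"
    by (simp_all add: vanishes_def D)
  moreover have "vanishes D (l j)" if "j \<le> n" for j
    using c[OF that] by (simp add: vanishes_def D \<alpha>_def \<beta>_def p_def)
  ultimately show thesis
    using that by blast
qed

section \<open>The grid\<close>

text \<open>\<open>D\<close> is the dual matrix of a non-degenerate conic touching all lines of the grid.\<close>

definition all_vanish :: "nat \<Rightarrow> nat \<Rightarrow> (nat \<Rightarrow> proj_line) \<Rightarrow> (nat \<Rightarrow> proj_line) \<Rightarrow> real^3^3 \<Rightarrow> bool" where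
  "all_vanish m n k l D \<longleftrightarrow> transpose D = D \<and> det D \<noteq> 0 \<and>
    (\<forall>i\<le>m. vanishes D (normal (k i))) \<and> (\<forall>j\<le>n. vanishes D (normal (l j)))"

lemma common_tangent_conic_iff: "common_tangent_conic m n k l \<longleftrightarrow> (\<exists>D. all_vanish m n k l D)"
proof
  assume "common_tangent_conic m n k l"
  then obtain C where C: "nondegenerate C" "\<forall>i\<le>m. tangent C (k i)" "\<forall>j\<le>n. tangent C (l j)"
    unfolding common_tangent_conic_def by auto
  obtain D where "transpose D = D" "det D \<noteq> 0" "C = dual_conic D"
    using nondegenerate_cases[OF C(1)] by blast
  then have "all_vanish m n k l D"
    using C(2,3) by (simp add: all_vanish_def tangent_dual_iff)
  then show "\<exists>D. all_vanish m n k l D" ..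
next
  assume "\<exists>D. all_vanish m n k l D"
  then obtain D where "all_vanish m n k l D" ..
  then have "nondegenerate (dual_conic D)" "\<forall>i\<in>{0..m}. tangent (dual_conic D) (k i)"
      "\<forall>j\<in>{0..n}. tangent (dual_conic D) (l j)"
    by (simp_all add: all_vanish_def tangent_dual_iff nondegenerate_dual_iff det_nonzero_cof)
  then show "common_tangent_conic m n k l"
    unfolding common_tangent_conic_def by blast
qed

lemma grid_propagate:
  fixes P :: "nat \<Rightarrow> nat \<Rightarrow> bool"
  assumes "\<And>i j. i \<in> {1..<m} \<Longrightarrow> j \<in> {1..n} \<Longrightarrow> P i j \<longleftrightarrow> P (i + 1) j"
    and "\<And>i j. i \<in> {1..m} \<Longrightarrow> j \<in> {1..<n} \<Longrightarrow> P i j \<longleftrightarrow> P i (j + 1)"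
    and "i0 \<in> {1..m}" "j0 \<in> {1..n}" "P i0 j0" and "i \<in> {1..m}" "j \<in> {1..n}"
  shows "P i j"
proof -
  have row: "P (Suc i) j \<longleftrightarrow> P 1 j" if "i < m" "j \<in> {1..n}" for i j
    using that
  proof (induction i)
    case (Suc i)
    then show ?case
      using assms(1)[of "Suc i" j] by simp
  qed simp
  have col: "P 1 (Suc j) \<longleftrightarrow> P 1 1" if "j < n" for j
    using that
  proof (induction j)
    case (Suc j)
    then show ?case
      using assms(2)[of 1 "Suc j"] assms(3) by simp
  qed simp
  have "P i j \<longleftrightarrow> P 1 1" if "i \<in> {1..m}" "j \<in> {1..n}" for i j
  proof -
    have "i - 1 < m" "j - 1 < n"
      using that by auto
    then show ?thesis
      using row[of "i - 1" j] col[of "j - 1"] that by simp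
  qed
  then show ?thesis
    using assms by blast
qed

locale grid =
  fixes m n :: nat and k l :: "nat \<Rightarrow> proj_line"
  assumes m2: "m \<ge> 2" and n3: "n \<ge> 3"
    and generic: "generic_lines (map k [0..<m + 1] @ map l [0..<n + 1])"
begin

abbreviation "K i \<equiv> normal (k i)"
abbreviation "L j \<equiv> normal (l j)"
abbreviation "cells \<equiv> SIGMA i : {1..m}. {1..n}"
abbreviation "lines \<equiv> k ` {..m} \<union> l ` {..n}"

lemma lines_distinct:
  "i \<le> m \<Longrightarrow> i' \<le> m \<Longrightarrow> k i = k i' \<longleftrightarrow> i = i'"
  "j \<le> n \<Longrightarrow> j' \<le> n \<Longrightarrow> l j = l j' \<longleftrightarrow> j = j'"
  "i \<le> m \<Longrightarrow> j \<le> n \<Longrightarrow> k i \<noteq> l j"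
  "i \<le> m \<Longrightarrow> j \<le> n \<Longrightarrow> l j \<noteq> k i"
proof -
  have "inj_on k {0..<m + 1}" "inj_on l {0..<n + 1}" "k ` {0..<m + 1} \<inter> l ` {0..<n + 1} = {}"
    using generic unfolding generic_lines_def by (auto simp: distinct_map simp del: upt_Suc)
  moreover from this(3) have "k i \<noteq> l j" if "i \<le> m" "j \<le> n" for i j
    using that imageI[of i "{0..<m + 1}" k] imageI[of j "{0..<n + 1}" l] by fastforce
  ultimately show "i \<le> m \<Longrightarrow> i' \<le> m \<Longrightarrow> k i = k i' \<longleftrightarrow> i = i'"
    "j \<le> n \<Longrightarrow> j' \<le> n \<Longrightarrow> l j = l j' \<longleftrightarrow> j = j'"
    "i \<le> m \<Longrightarrow> j \<le> n \<Longrightarrow> k i \<noteq> l j" "i \<le> m \<Longrightarrow> j \<le> n \<Longrightarrow> l j \<noteq> k i"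
    by (auto simp: inj_on_eq_iff dest: sym)
qed

lemma bracket_lines_nonzero:
  assumes "a \<in> lines" "b \<in> lines" "c \<in> lines" "a \<noteq> b" "b \<noteq> c" "a \<noteq> c"
  shows "bracket (normal a) (normal b) (normal c) \<noteq> 0"
proof -
  have lines: "set (map k [0..<m + 1] @ map l [0..<n + 1]) = lines"
    by (auto simp: less_Suc_eq_le atMost_def image_iff simp del: upt_Suc)
  have "\<forall>a\<in>lines. \<forall>b\<in>lines. \<forall>c\<in>lines. a \<noteq> b \<and> b \<noteq> c \<and> a \<noteq> c \<longrightarrow>
      \<not> (\<exists>p. on_line p a \<and> on_line p b \<and> on_line p c)"
    using generic unfolding generic_lines_def lines by (rule conjunct2)
  then have "\<not> (\<exists>p. on_line p a \<and> on_line p b \<and> on_line p c)"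
    using assms by blast
  then show ?thesis
    using bracket_normal_eq_0[OF assms(4)] by blast
qed

lemma quad_linesI:
  assumes "a \<in> lines" "b \<in> lines" "a' \<in> lines" "b' \<in> lines"
    "a \<noteq> b" "a \<noteq> a'" "a \<noteq> b'" "b \<noteq> a'" "b \<noteq> b'" "a' \<noteq> b'"
  shows "quad_lines a b a' b'"
  by unfold_locales (rule bracket_lines_nonzero; use assms in simp)+

lemma five_linesI:
  assumes "a \<in> lines" "b \<in> lines" "a' \<in> lines" "b' \<in> lines" "e \<in> lines"
    "a \<noteq> b" "a \<noteq> a'" "a \<noteq> b'" "b \<noteq> a'" "b \<noteq> b'" "a' \<noteq> b'" "e \<noteq> a" "e \<noteq> b" "e \<noteq> a'" "e \<noteq> b'"
  shows "five_lines (normal a) (normal b) (normal a') (normal b') (normal e)"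
  by unfold_locales (rule bracket_lines_nonzero; use assms in simp)+

lemma grid_quad_lines:
  assumes "i \<in> {1..m}" "j \<in> {1..n}"
  shows "quad_lines (k (i - 1)) (l (j - 1)) (k i) (l j)"
  using assms by (intro quad_linesI) (auto simp: lines_distinct)

lemma all_vanishI:
  assumes D: "transpose D = D" "D \<noteq> 0" "\<And>i. i \<le> m \<Longrightarrow> vanishes D (K i)" "\<And>j. j \<le> n \<Longrightarrow> vanishes D (L j)"
  shows "all_vanish m n k l D"
proof -
  have "five_lines (K 0) (L 0) (K 1) (L 1) (L 2)"
    using m2 n3 by (intro five_linesI) (auto simp: lines_distinct)
  then have "det D \<noteq> 0"
    using five_lines.det_vanishing_nonzero[of "K 0" "L 0" "K 1" "L 1" "L 2" D] D m2 n3 by simp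
  then show ?thesis
    using D by (simp add: all_vanish_def)
qed

section \<open>Instances as solutions of a multiplicative system\<close>

text \<open>Restricting to the cells makes an instance determined by its parameters.\<close>

definition conics :: "(nat \<times> nat \<Rightarrow> real) \<Rightarrow> nat \<times> nat \<Rightarrow> conic" where
  "conics c = restrict (\<lambda>(i, j). inscribed_conic (grid_quad k l i j) (c (i, j))) cells"

text \<open>The equations for the edge on \<open>k i\<close> are \<open>c * c' * kfac i j = kval i j\<close> for the parameters
  \<open>c, c'\<close> of its two cells, those for the edge on \<open>l j\<close> are \<open>c * c' * lfac i j = lval i j\<close>.\<close>

definition kfac :: "nat \<Rightarrow> nat \<Rightarrow> real" where
  "kfac i j = bracket (K i) (K (i - 1)) (L (j - 1)) * bracket (K i) (K (i + 1)) (L j)"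

definition kval :: "nat \<Rightarrow> nat \<Rightarrow> real" where
  "kval i j = bracket (K i) (K (i - 1)) (L j) * bracket (K i) (K (i + 1)) (L (j - 1))"

definition lfac :: "nat \<Rightarrow> nat \<Rightarrow> real" where
  "lfac i j = bracket (L j) (L (j - 1)) (K (i - 1)) * bracket (L j) (L (j + 1)) (K i)"

definition lval :: "nat \<Rightarrow> nat \<Rightarrow> real" where
  "lval i j = bracket (L j) (L (j - 1)) (K i) * bracket (L j) (L (j + 1)) (K (i - 1))"

definition solution :: "(nat \<times> nat \<Rightarrow> real) \<Rightarrow> bool" where
  "solution c \<longleftrightarrow>
    (\<forall>i\<in>{1..m}. \<forall>j\<in>{1..n}. c (i, j) \<noteq> 0) \<and>
    (\<forall>i\<in>{1..<m}. \<forall>j\<in>{1..n}. c (i, j) * c (i + 1, j) * kfac i j = kval i j) \<and>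
    (\<forall>i\<in>{1..m}. \<forall>j\<in>{1..<n}. c (i, j) * c (i, j + 1) * lfac i j = lval i j)"

lemma factors_nonzero:
  shows "i \<in> {1..<m} \<Longrightarrow> j \<in> {1..n} \<Longrightarrow> kfac i j \<noteq> 0"
    and "i \<in> {1..m} \<Longrightarrow> j \<in> {1..<n} \<Longrightarrow> lfac i j \<noteq> 0"
  unfolding kfac_def lfac_def mult_eq_0_iff de_Morgan_disj
  by (intro conjI bracket_lines_nonzero; auto simp: lines_distinct)+

lemma touching_on_k:
  assumes "i \<in> {1..<m}" "j \<in> {1..n}" "x \<noteq> 0" "y \<noteq> 0"
  shows "tangency_point (inscribed_conic (grid_quad k l i j) x) (k i) =
      tangency_point (inscribed_conic (grid_quad k l (i + 1) j) y) (k i) \<longleftrightarrow> x * y * kfac i j =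
          kval i j"
proof -
  have "quad_lines (k (i - 1)) (l (j - 1)) (k i) (l j)"
      "quad_lines (k i) (l (j - 1)) (k (i + 1)) (l j)"
    using grid_quad_lines[of i j] grid_quad_lines[of "i + 1" j] assms by simp_all
  from touching_iff[OF this assms(3,4)] show ?thesis
    by (simp add: grid_quad_def kfac_def kval_def)
qed

lemma touching_on_l:
  assumes "i \<in> {1..m}" "j \<in> {1..<n}" "x \<noteq> 0" "y \<noteq> 0"
  shows "tangency_point (inscribed_conic (grid_quad k l i j) x) (l j) =
      tangency_point (inscribed_conic (grid_quad k l i (j + 1)) y) (l j) \<longleftrightarrow> x * y * lfac i j =
          lval i j"
proof -
  have "quad_lines (l (j - 1)) (k (i - 1)) (l j) (k i)"
      "quad_lines (l j) (k (i - 1)) (l (j + 1)) (k i)"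
    using assms by (intro quad_linesI; auto simp: lines_distinct)+
  from touching_iff[OF this assms(3,4)] show ?thesis
    by (simp add: grid_quad_def lfac_def lval_def pencil_swap)
qed

lemma inscribed_grid_iff:
  assumes "i \<in> {1..m}" "j \<in> {1..n}"
  shows "inscribed C (grid_quad k l i j) \<longleftrightarrow> (\<exists>x. x \<noteq> 0 \<and> C = inscribed_conic (grid_quad k l i j) x)"
  unfolding grid_quad_def using quad_lines.inscribed_iff[OF grid_quad_lines[OF assms]] .

lemma touching_instance_conics:
  assumes nz: "\<And>i j. i \<in> {1..m} \<Longrightarrow> j \<in> {1..n} \<Longrightarrow> c (i, j) \<noteq> 0"
  shows "touching_instance m n k l (conics c) \<longleftrightarrow> solution c"
proof -
  have "inscribed (conics c (i, j)) (grid_quad k l i j)" if "i \<in> {1..m}" "j \<in> {1..n}" for i j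
    using that nz[OF that] inscribed_grid_iff[OF that] by (auto simp: conics_def)
  moreover have "conics c \<in> extensional cells"
    by (simp add: conics_def)
  moreover have "tangency_point (conics c (i, j)) (k i) =
      tangency_point (conics c (i + 1, j)) (k i) \<longleftrightarrow>
      c (i, j) * c (i + 1, j) * kfac i j = kval i j" if "i \<in> {1..<m}" "j \<in> {1..n}" for i j
    using touching_on_k[OF that nz nz, of i j "i + 1" j] that by (simp add: conics_def)
  moreover have "tangency_point (conics c (i, j)) (l j) =
      tangency_point (conics c (i, j + 1)) (l j) \<longleftrightarrow>
      c (i, j) * c (i, j + 1) * lfac i j = lval i j" if "i \<in> {1..m}" "j \<in> {1..<n}" for i j
    using touching_on_l[OF that nz nz, of i j i "j + 1"] that by (simp add: conics_def)
  ultimately show ?thesis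
    unfolding touching_instance_def solution_def using nz by simp
qed

lemma touching_instance_iff: "touching_instance m n k l C \<longleftrightarrow> (\<exists>c. solution c \<and> C = conics c)"
proof
  assume C: "touching_instance m n k l C"
  then have "\<forall>p\<in>cells. \<exists>x. x \<noteq> 0 \<and> C p = inscribed_conic (grid_quad k l (fst p) (snd p)) x"
    unfolding touching_instance_def using inscribed_grid_iff by auto
  then obtain c where c: "\<And>p. p \<in> cells \<Longrightarrow>
      c p \<noteq> 0 \<and> C p = inscribed_conic (grid_quad k l (fst p) (snd p)) (c p)"
    by metis
  have "C = conics c"
    using C c by (intro extensionalityI[of _ cells])
      (auto simp: touching_instance_def conics_def)
  then show "\<exists>c. solution c \<and> C = conics c"
    using C c touching_instance_conics[of c] by fastforce
next
  assume "\<exists>c. solution c \<and> C = conics c"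
  then show "touching_instance m n k l C"
    using touching_instance_conics solution_def by blast
qed

text \<open>Adjacent cells have different colours, so that the product of their parameters does not
  change.\<close>

lemma solution_rescale:
  assumes "solution c" "x \<noteq> 0"
  shows "solution (\<lambda>(i, j). if even (i + j) then c (i, j) * x else c (i, j) / x)"
  using assms unfolding solution_def by (auto simp: field_simps)

text \<open>In each equation one parameter determines the other, so a solution is determined by its
  value in one cell.\<close>

lemma solution_unique:
  assumes "solution c" "solution d" and "i0 \<in> {1..m}" "j0 \<in> {1..n}" "c (i0, j0) = d (i0, j0)"
  shows "conics c = conics d"
proof -
  have cancel: "x = x' \<longleftrightarrow> y = y'" if "x * y * f = v" "x' * y' * f = v" "f \<noteq> 0" "x \<noteq> 0" "y \<noteq> 0"
      "x' \<noteq> 0" "y' \<noteq> 0"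
    for x y x' y' f v :: real
    using that by auto
  have "c (i, j) = d (i, j)" if "i \<in> {1..m}" "j \<in> {1..n}" for i j
  proof (rule grid_propagate[where P = "\<lambda>i j. c (i, j) = d (i, j)", OF _ _ assms(3-5) that])
    fix i j
    assume ij: "i \<in> {1..<m}" "j \<in> {1..n}"
    then show "c (i, j) = d (i, j) \<longleftrightarrow> c (i + 1, j) = d (i + 1, j)"
      using assms(1,2) factors_nonzero(1)[OF ij]
      by (intro cancel[of _ _ "kfac i j" "kval i j"]) (auto simp: solution_def)
  next
    fix i j
    assume ij: "i \<in> {1..m}" "j \<in> {1..<n}"
    then show "c (i, j) = d (i, j) \<longleftrightarrow> c (i, j + 1) = d (i, j + 1)"
      using assms(1,2) factors_nonzero(2)[OF ij]
      by (intro cancel[of _ _ "lfac i j" "lval i j"]) (auto simp: solution_def)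
  qed
  then show ?thesis
    by (auto simp: conics_def fun_eq_iff restrict_def)
qed

text \<open>A point on an edge that is not an endpoint determines the parameter of the cell, and
  rescaling a given solution attains it.\<close>

lemma one_parameter_family_iff: "one_parameter_family m n k l \<longleftrightarrow> (\<exists>C. touching_instance m n k l C)"
proof
  assume family: "one_parameter_family m n k l"
  have 1: "1 \<in> {1..m}" "1 \<in> {1..n}"
    using m2 n3 by auto
  interpret quad_lines "k 0" "l 0" "k 1" "l 1"
    using grid_quad_lines[OF 1] by simp
  have "k 0 \<in> edge_lines Q"
    by simp
  note p = tangency_point_not_vertex[OF this one_neq_zero]
  have "grid_quad k l 1 1 = Q"
    by (simp add: grid_quad_def)
  then show "\<exists>C. touching_instance m n k l C"
    using family[unfolded one_parameter_family_def, rule_format, OF 1, unfolded \<open>grid_quad k l 1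
        1 = Q\<close>,
        OF \<open>k 0 \<in> edge_lines Q\<close> conjI[OF p(2,1)]] by blast
next
  assume "\<exists>C. touching_instance m n k l C"
  then obtain c where c: "solution c"
    using touching_instance_iff by blast
  show "one_parameter_family m n k l"
    unfolding one_parameter_family_def
  proof (intro ballI allI impI, elim conjE)
    fix i j e p
    assume ij: "i \<in> {1..m}" "j \<in> {1..n}" and e: "e \<in> edge_lines (grid_quad k l i j)"
      and p: "on_line p e" "p \<notin> vertices (grid_quad k l i j)"
    interpret quad_lines "k (i - 1)" "l (j - 1)" "k i" "l j"
      using grid_quad_lines[OF ij] .
    have Q: "grid_quad k l i j = Q"
      by (simp add: grid_quad_def)
    obtain x where x: "x \<noteq> 0" "p = tangency_point (inscribed_conic Q x) e"
      using tangency_point_surj e p unfolding Q by metis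
    have cij: "c (i, j) \<noteq> 0"
      using c ij by (simp add: solution_def)
    have conics: "conics d (i, j) = inscribed_conic Q (d (i, j))" for d
      using ij by (simp add: conics_def grid_quad_def)
    \<comment> \<open>the rescaling factor that moves the parameter of the cell \<open>(i, j)\<close>, of either colour, to \<open>x\<close>\<close>
    define y where "y = (if even (i + j) then x / c (i, j) else c (i, j) / x)"
    define d where "d = (\<lambda>(i, j). if even (i + j) then c (i, j) * y else c (i, j) / y)"
    have "solution d"
      unfolding d_def using x cij by (intro solution_rescale c) (simp add: y_def)
    have "d (i, j) = x"
      using x cij by (simp add: d_def y_def)
    show "\<exists>!C. touching_instance m n k l C \<and> tangency_point (C (i, j)) e = p"
    proof (rule ex1I)
      show "touching_instance m n k l (conics d) \<and> tangency_point (conics d (i, j)) e = p"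
        using \<open>solution d\<close> touching_instance_iff unfolding conics x(2) \<open>d (i, j) = x\<close> by blast
    next
      fix C
      assume C: "touching_instance m n k l C \<and> tangency_point (C (i, j)) e = p"
      then obtain d' where d': "solution d'" "C = conics d'"
        using touching_instance_iff by blast
      then have "d' (i, j) = x"
        using C tangency_point_inscribed_eq_iff[OF e[unfolded Q]] unfolding x(2) d'(2) conics
            by blast
      then show "C = conics d"
        using solution_unique[OF d'(1) \<open>solution d\<close> ij] d'(2) \<open>d (i, j) = x\<close> by simp
    qed
  qed
qed

end

section \<open>From instances to a common tangent conic\<close>

text \<open>The four equations around an inner vertex involve each of the four parameters twice.
  Multiplying opposite ones gives the product of all parameters in two ways; the numbers
  \<open>p2, q2, r2, s2\<close>, brackets that contain both lines through the vertex, cancel.\<close>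

lemma cocycle:
  fixes c11 c12 c21 c22 :: real
  assumes "c11 * c21 * (p1 * q2) = p2 * q1" "c12 * c22 * (p2 * q3) = p3 * q2"
    and "c11 * c12 * (r1 * s2) = r2 * s1" "c21 * c22 * (r2 * s3) = r3 * s2"
    and "p2 \<noteq> 0" "q2 \<noteq> 0" "r2 \<noteq> 0" "s2 \<noteq> 0"
  shows "q1 * p3 * (r1 * s3) = s1 * r3 * (p1 * q3)"
proof -
  define d where "d = c11 * c12 * c21 * c22"
  have "(d * (p1 * q3)) * (p2 * q2) = (q1 * p3) * (p2 * q2)"
    using assms(1,2) unfolding d_def by algebra
  then have "d * (p1 * q3) = q1 * p3"
    using assms(5,6) by simp
  moreover have "(d * (r1 * s3)) * (r2 * s2) = (s1 * r3) * (r2 * s2)"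
    using assms(3,4) unfolding d_def by algebra
  then have "d * (r1 * s3) = s1 * r3"
    using assms(7,8) by simp
  ultimately show ?thesis
    by algebra
qed

context grid
begin

text \<open>The lines bounding the four cells that meet in \<open>k i \<inter> l j\<close>.\<close>

definition lines_around :: "nat \<Rightarrow> nat \<Rightarrow> proj_line set" where
  "lines_around i j = {k (i - 1), k i, k (i + 1), l (j - 1), l j, l (j + 1)}"

lemma solution_six_lines:
  assumes c: "solution c" and i: "i \<in> {1..<m}" and j: "j \<in> {1..<n}"
  obtains D where "transpose D = D" "D \<noteq> 0" "\<And>e. e \<in> lines_around i j \<Longrightarrow> vanishes D (normal e)"
proof -
  let ?X = "K (i - 1)" and ?Y = "K i" and ?Z = "K (i + 1)"
  let ?U = "L (j - 1)" and ?V = "L j" and ?W = "L (j + 1)"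
  have "c (i, j) * c (i + 1, j) * kfac i j = kval i j"
    "c (i, j + 1) * c (i + 1, j + 1) * kfac i (j + 1) = kval i (j + 1)"
    "c (i, j) * c (i, j + 1) * lfac i j = lval i j"
    "c (i + 1, j) * c (i + 1, j + 1) * lfac (i + 1) j = lval (i + 1) j"
    using c i j unfolding solution_def by auto
  note eqs = this[unfolded kfac_def kval_def lfac_def lval_def add_diff_cancel_right']
  have nz: "bracket ?Y ?X ?V \<noteq> 0" "bracket ?Y ?Z ?V \<noteq> 0" "bracket ?V ?U ?Y \<noteq> 0"
      "bracket ?V ?W ?Y \<noteq> 0"
    "bracket ?X ?U ?Y \<noteq> 0" "bracket ?Z ?W ?Y \<noteq> 0"
    using i j by (intro bracket_lines_nonzero; auto simp: lines_distinct)+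
  have "quad_lines (k (i - 1)) (l (j + 1)) (k (i + 1)) (l (j - 1))"
    using i j by (intro quad_linesI) (auto simp: lines_distinct)
  then have quad: "quadrilateral ?X ?W ?Z ?U"
    by (rule quad_lines.quadrilateral)
  obtain D where "transpose D = D" "D \<noteq> 0" "vanishes D ?X" "vanishes D ?Y" "vanishes D ?Z"
    "vanishes D ?U" "vanishes D ?V" "vanishes D ?W"
    using six_lines[OF quad nz(5,6) cocycle[OF eqs nz(1-4)]] .
  then show thesis
    using that[of D] by (auto simp: lines_around_def)
qed

text \<open>The form found at the vertex \<open>k 1 \<inter> l 1\<close> vanishes on the lines around every inner vertex,
  because the lines around neighbouring vertices have five lines in common.\<close>

lemma solution_imp_common_conic:
  assumes c: "solution c"
  shows "\<exists>D. all_vanish m n k l D"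
proof -
  have "1 \<in> {1..<m}" "1 \<in> {1..<n}"
    using m2 n3 by auto
  then obtain D where D: "transpose D = D" "D \<noteq> 0" and D11: "\<And>e. e \<in> lines_around 1 1 \<Longrightarrow>
      vanishes D (normal e)"
    using solution_six_lines[OF c] by blast
  define P where "P i j \<longleftrightarrow> (\<forall>e\<in>lines_around i j. vanishes D (normal e))" for i j
  have transfer: "P i j"
    if ij: "i \<in> {1..<m}" "j \<in> {1..<n}" and five: "five_lines (normal a) (normal b) (normal a')
        (normal b') (normal e)"
      and sub: "{a, b, a', b', e} \<subseteq> lines_around i j" and
          van: "\<forall>x\<in>{a, b, a', b', e}. vanishes D (normal x)"
    for i j a b a' b' e
  proof -
    obtain D' where D': "transpose D' = D'" "D' \<noteq> 0"
        "\<And>e. e \<in> lines_around i j \<Longrightarrow> vanishes D' (normal e)"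
      using solution_six_lines[OF c ij] by blast
    have "vanishes D (normal x)" if "x \<in> lines_around i j" for x
      by (rule five_lines.vanishing_transfer[OF five D'(1) _ _ _ _ _ D(1) _ _ _ _ _ D'(2) D'(3)[OF
          that]])
        (use sub van D'(3) in auto)
    then show ?thesis
      by (simp add: P_def)
  qed
  have P: "P i j" if "i \<in> {1..m - 1}" "j \<in> {1..n - 1}" for i j
  proof (rule grid_propagate[where P = P, OF _ _ _ _ _ that])
    show "1 \<in> {1..m - 1}" "1 \<in> {1..n - 1}" "P 1 1"
      using m2 n3 D11 by (auto simp: P_def)
  next
    fix i j
    assume ij: "i \<in> {1..<m - 1}" "j \<in> {1..n - 1}"
    have five: "five_lines (K i) (L (j - 1)) (K (i + 1)) (L j) (L (j + 1))"
      using ij by (intro five_linesI) (auto simp: lines_distinct)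
    have sub: "{k i, l (j - 1), k (i + 1), l j, l (j + 1)} \<subseteq> lines_around i j"
      "{k i, l (j - 1), k (i + 1), l j, l (j + 1)} \<subseteq> lines_around (i + 1) j"
      by (auto simp: lines_around_def)
    show "P i j \<longleftrightarrow> P (i + 1) j"
    proof
      assume "P i j"
      then show "P (i + 1) j"
        using ij sub by (intro transfer[OF _ _ five]) (auto simp: P_def)
    next
      assume "P (i + 1) j"
      then show "P i j"
        using ij sub by (intro transfer[OF _ _ five]) (auto simp: P_def)
    qed
  next
    fix i j
    assume ij: "i \<in> {1..m - 1}" "j \<in> {1..<n - 1}"
    have five: "five_lines (K (i - 1)) (L j) (K i) (L (j + 1)) (K (i + 1))"
      using ij by (intro five_linesI) (auto simp: lines_distinct)
    have sub: "{k (i - 1), l j, k i, l (j + 1), k (i + 1)} \<subseteq> lines_around i j"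
      "{k (i - 1), l j, k i, l (j + 1), k (i + 1)} \<subseteq> lines_around i (j + 1)"
      by (auto simp: lines_around_def)
    show "P i j \<longleftrightarrow> P i (j + 1)"
    proof
      assume "P i j"
      then show "P i (j + 1)"
        using ij sub by (intro transfer[OF _ _ five]) (auto simp: P_def)
    next
      assume "P i (j + 1)"
      then show "P i j"
        using ij sub by (intro transfer[OF _ _ five]) (auto simp: P_def)
    qed
  qed
  have "vanishes D (K i)" if "i \<le> m" for i
  proof -
    \<comment> \<open>some inner index whose neighbourhood contains \<open>i\<close>\<close>
    define i' where "i' = (if i = 0 then 1 else if i = m then m - 1 else i)"
    have "i' \<in> {1..m - 1}" "1 \<in> {1..n - 1}" "k i \<in> lines_around i' 1"
      using that m2 n3 by (auto simp: i'_def lines_around_def)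
    then show ?thesis
      using P P_def by blast
  qed
  moreover have "vanishes D (L j)" if "j \<le> n" for j
  proof -
    define j' where "j' = (if j = 0 then 1 else if j = n then n - 1 else j)"
    have "1 \<in> {1..m - 1}" "j' \<in> {1..n - 1}" "l j \<in> lines_around 1 j'"
      using that m2 n3 by (auto simp: j'_def lines_around_def)
    then show ?thesis
      using P P_def by blast
  qed
  ultimately show ?thesis
    using all_vanishI[OF D] by blast
qed

lemma consecutive_cross_nonzero:
  "i \<in> {1..m} \<Longrightarrow> K (i - 1) \<times> K i \<noteq> 0" "j \<in> {1..n} \<Longrightarrow> L (j - 1) \<times> L j \<noteq> 0"
proof -
  have "1 \<in> {1..m}" "1 \<in> {1..n}"
    using m2 n3 by auto
  then show "i \<in> {1..m} \<Longrightarrow> K (i - 1) \<times> K i \<noteq> 0" "j \<in> {1..n} \<Longrightarrow> L (j - 1) \<times> L j \<noteq> 0"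
    using grid_quad_lines[THEN quad_lines.quadrilateral, THEN quadrilateral.cross_edges_nonzero(5)]
      grid_quad_lines[THEN quad_lines.quadrilateral, THEN quadrilateral.cross_edges_nonzero(6)]
          by blast+
qed

section \<open>From a common tangent conic to instances and diagonals\<close>

text \<open>All points of contact on \<open>l (j - 1)\<close> and \<open>l j\<close> of the conics in strip \<open>i\<close> lie on the polar
  of \<open>p i\<close>, and this line does not depend on \<open>j\<close>. So they are collinear, and neighbouring conics
  meet \<open>l j\<close> in the same point of this line; likewise for the other direction.\<close>

lemma common_conic_imp_collinear_instance:
  assumes "all_vanish m n k l D"
  shows "\<exists>C. touching_instance m n k l C \<and> collinear_tangency_points m n k l C"
proof -
  have D: "transpose D = D" "det D \<noteq> 0" and van: "\<And>i. i \<le> m \<Longrightarrow> vanishes D (K i)"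
      "\<And>j. j \<le> n \<Longrightarrow> vanishes D (L j)"
    using assms by (simp_all add: all_vanish_def)
  define p where "p i = K (i - 1) \<times> K i" for i
  define r where "r j = L (j - 1) \<times> L j" for j
  define B where "B i j = contact_dual D (p i) (r j)" for i j
  define C where "C = restrict (\<lambda>(i, j). dual_conic (B i j)) cells"
  have B: "inscribed (dual_conic (B i j)) (grid_quad k l i j) \<and>
      (\<forall>e\<in>{k (i - 1), k i, l (j - 1), l j}.
      tangency_point (dual_conic (B i j)) e = point_of (B i j *v normal e) \<and>
      B i j *v normal e \<noteq> 0 \<and> (B i j *v normal e) \<bullet> normal e = 0)"
    if ij: "i \<in> {1..m}" "j \<in> {1..n}" for i j
  proof -
    interpret quad_lines "k (i - 1)" "l (j - 1)" "k i" "l j"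
      using grid_quad_lines[OF ij] .
    have "i - 1 \<le> m" "j - 1 \<le> n" "i \<le> m" "j \<le> n"
      using ij by auto
    then have v: "vanishes D (K (i - 1))" "vanishes D (L (j - 1))" "vanishes D (K i)"
        "vanishes D (L j)"
      by (simp_all add: van)
    obtain s t where st: "s \<noteq> 0" "t \<noteq> 0" "B i j = pen s t"
      using contact_dual_in_pencil[OF D(1) v D(2)] unfolding B_def p_def r_def .
    have "inscribed (dual_conic (pen s t)) Q"
      unfolding inscribed_iff dual_conic_pencil[OF st(2)] using st(1,2)
          by (intro exI[of _ "s / t"]) simp
    moreover have "tangency_point (dual_conic (pen s t)) e = point_of (pen s t *v normal e) \<and>
        pen s t *v normal e \<noteq> 0 \<and> (pen s t *v normal e) \<bullet> normal e = 0" if "e \<in> edge_lines Q" for e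
      using tangency_point_pencil[OF that disjI1[OF st(1)]] pencil_edge_nonzero[OF that disjI1[OF
          st(1)]]
        pencil_edge_vanishes[OF that] unfolding vanishes_def inner_commute[of "normal e"] by blast
    ultimately show ?thesis
      unfolding st(3) grid_quad_def by simp
  qed
  have E: "cof D *v v \<noteq> 0" if "v \<noteq> 0" for v
    using that det_nonzero_mult[OF cof_symmetric[OF D(1)]] D(2) by (simp add: det_cof)
  have on_l: "(B i j *v L j') \<bullet> (cof D *v p i) = 0" if "j' = j \<or> j' = j - 1" for i j j'
    unfolding B_def using that by (intro contact_dual_polar D) (auto simp: r_def dot_cross_self)
  have on_k: "(B i j *v K i') \<bullet> (cof D *v r j) = 0" if "i' = i \<or> i' = i - 1" for i j i'
    unfolding B_def contact_dual_commute[OF D(1), of "r j", symmetric] using that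
    by (intro contact_dual_polar D) (auto simp: p_def dot_cross_self)
  have "touching_instance m n k l C"
    unfolding touching_instance_def
  proof (intro conjI ballI)
    show "C \<in> extensional cells"
      by (simp add: C_def)
  next
    fix i j assume "i \<in> {1..m}" "j \<in> {1..n}"
    then show "inscribed (C (i, j)) (grid_quad k l i j)"
      using B by (simp add: C_def)
  next
    fix i j assume ij: "i \<in> {1..<m}" "j \<in> {1..n}"
    have "quad_lines (l (j - 1)) (k i) (l j) (k (i - 1))"
      using ij by (intro quad_linesI) (auto simp: lines_distinct)
    note quad = quad_lines.quadrilateral[OF this]
    have "i - 1 \<le> m" "j - 1 \<le> n" "i \<le> m" "j \<le> n"
      using ij by auto
    then have v: "vanishes D (L (j - 1))" "vanishes D (K i)" "vanishes D (L j)"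
        "vanishes D (K (i - 1))"
      by (simp_all add: van)
    have "K i \<times> (cof D *v r j) \<noteq> 0"
      unfolding r_def using quadrilateral.polar_not_edge[OF quad D(1) v D(2)] .
    then have "point_of (B i j *v K i) = point_of (B (i + 1) j *v K i)"
      using B[of i j] B[of "i + 1" j] on_k[of i i j] on_k[of i "i + 1" j] ij
      by (intro point_of_eqI[of "K i" "cof D *v r j"]) auto
    then show "tangency_point (C (i, j)) (k i) = tangency_point (C (i + 1, j)) (k i)"
      using B[of i j] B[of "i + 1" j] ij by (simp add: C_def)
  next
    fix i j assume ij: "i \<in> {1..m}" "j \<in> {1..<n}"
    have "quad_lines (k (i - 1)) (l j) (k i) (l (j - 1))"
      using ij by (intro quad_linesI) (auto simp: lines_distinct)
    note quad = quad_lines.quadrilateral[OF this]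
    have "i - 1 \<le> m" "j - 1 \<le> n" "i \<le> m" "j \<le> n"
      using ij by auto
    then have v: "vanishes D (K (i - 1))" "vanishes D (L j)" "vanishes D (K i)"
        "vanishes D (L (j - 1))"
      by (simp_all add: van)
    have "L j \<times> (cof D *v p i) \<noteq> 0"
      unfolding p_def using quadrilateral.polar_not_edge[OF quad D(1) v D(2)] .
    then have "point_of (B i j *v L j) = point_of (B i (j + 1) *v L j)"
      using B[of i j] B[of i "j + 1"] on_l[of j j i] on_l[of j "j + 1" i] ij
      by (intro point_of_eqI[of "L j" "cof D *v p i"]) auto
    then show "tangency_point (C (i, j)) (l j) = tangency_point (C (i, j + 1)) (l j)"
      using B[of i j] B[of i "j + 1"] ij by (simp add: C_def)
  qed
  moreover have "collinear_tangency_points m n k l C"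
    unfolding collinear_tangency_points_def
  proof (intro conjI ballI)
    fix i assume i: "i \<in> {1..m}"
    have "p i \<noteq> 0"
      unfolding p_def using consecutive_cross_nonzero(1)[OF i] .
    then show "proj_collinear (\<Union>j\<in>{1..n}. {tangency_point (C (i, j)) (l (j -
        1)), tangency_point (C (i, j)) (l j)})"
    proof (rule proj_collinear_point_of[OF E])
      fix q assume "q \<in> (\<Union>j\<in>{1..n}. {tangency_point (C (i, j)) (l (j -
          1)), tangency_point (C (i, j)) (l j)})"
      then obtain j j' where j: "j \<in> {1..n}" "j' = j \<or> j' = j - 1"
          "q = tangency_point (C (i, j)) (l j')"
        by blast
      then have "q = point_of (B i j *v L j') \<and> B i j *v L j' \<noteq> 0"
        using B[OF i j(1)] i by (auto simp: C_def)
      then show "\<exists>v. v \<noteq> 0 \<and> q = point_of v \<and> (cof D *v p i) \<bullet> v = 0"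
        using on_l[OF j(2)] by (metis inner_commute)
    qed
  next
    fix j assume j: "j \<in> {1..n}"
    have "r j \<noteq> 0"
      unfolding r_def using consecutive_cross_nonzero(2)[OF j] .
    then show "proj_collinear (\<Union>i\<in>{1..m}. {tangency_point (C (i, j)) (k (i -
        1)), tangency_point (C (i, j)) (k i)})"
    proof (rule proj_collinear_point_of[OF E])
      fix q assume "q \<in> (\<Union>i\<in>{1..m}. {tangency_point (C (i, j)) (k (i -
          1)), tangency_point (C (i, j)) (k i)})"
      then obtain i i' where i: "i \<in> {1..m}" "i' = i \<or> i' = i - 1"
          "q = tangency_point (C (i, j)) (k i')"
        by blast
      then have "q = point_of (B i j *v K i') \<and> B i j *v K i' \<noteq> 0"
        using B[OF i(1) j] j by (auto simp: C_def)
      then show "\<exists>v. v \<noteq> 0 \<and> q = point_of v \<and> (cof D *v r j) \<bullet> v = 0"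
        using on_k[OF i(2)] by (metis inner_commute)
    qed
  qed
  ultimately show ?thesis
    by blast
qed

lemma common_conic_imp_collinear_diagonals:
  assumes "all_vanish m n k l D"
  shows "collinear_column_diagonals m n k l" "collinear_row_diagonals m n k l"
proof -
  have D: "transpose D = D" "det D \<noteq> 0" and van: "\<And>i. i \<le> m \<Longrightarrow> vanishes D (K i)"
      "\<And>j. j \<le> n \<Longrightarrow> vanishes D (L j)"
    using assms by (simp_all add: all_vanish_def)
  have E: "cof D *v v \<noteq> 0" if "v \<noteq> 0" for v
    using that det_nonzero_mult[OF cof_symmetric[OF D(1)]] D(2) by (simp add: det_cof)
  have diag: "\<exists>v. v \<noteq> 0 \<and> diagonals_meet (grid_quad k l i j) = point_of v \<and>
      (cof D *v (K (i - 1) \<times> K i)) \<bullet> v = 0 \<and> (cof D *v (L (j - 1) \<times> L j)) \<bullet> v = 0"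
    if ij: "i \<in> {1..m}" "j \<in> {1..n}" for i j
  proof -
    interpret quad_lines "k (i - 1)" "l (j - 1)" "k i" "l j"
      using grid_quad_lines[OF ij] .
    have "i - 1 \<le> m" "j - 1 \<le> n" "i \<le> m" "j \<le> n"
      using ij by auto
    then have v: "vanishes D (K (i - 1))" "vanishes D (L (j - 1))" "vanishes D (K i)"
        "vanishes D (L j)"
      by (simp_all add: van)
    show ?thesis
      unfolding grid_quad_def
      using diagonals_meet_eq diagonal_point_nonzero diagonal_point_polar[OF D(1) v D(2)] by blast
  qed
  show "collinear_column_diagonals m n k l"
    unfolding collinear_column_diagonals_def
  proof
    fix j assume j: "j \<in> {1..n}"
    have "L (j - 1) \<times> L j \<noteq> 0"
      using consecutive_cross_nonzero(2)[OF j] .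
    then show "proj_collinear ((\<lambda>i. diagonals_meet (grid_quad k l i j)) ` {1..m})"
      by (rule proj_collinear_point_of[OF E]) (use diag j in blast)
  qed
  show "collinear_row_diagonals m n k l"
    unfolding collinear_row_diagonals_def
  proof
    fix i assume i: "i \<in> {1..m}"
    have "K (i - 1) \<times> K i \<noteq> 0"
      using consecutive_cross_nonzero(1)[OF i] .
    then show "proj_collinear ((\<lambda>j. diagonals_meet (grid_quad k l i j)) ` {1..n})"
      by (rule proj_collinear_point_of[OF E]) (use diag i in blast)
  qed
qed

section \<open>From collinear diagonal points to a common tangent conic\<close>

lemma row_conic:
  assumes "collinear_row_diagonals m n k l" and i: "i \<in> {1..m}"
  obtains D where "transpose D = D" "D \<noteq> 0" "vanishes D (K (i - 1))" "vanishes D (K i)"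
    "\<And>j. j \<le> n \<Longrightarrow> vanishes D (L j)"
proof -
  obtain a where a: "\<And>j. j \<in> {1..n} \<Longrightarrow> on_line (diagonals_meet (grid_quad k l i j)) a"
    using assms unfolding collinear_row_diagonals_def proj_collinear_def by blast
  have quads: "quadrilateral (K (i - 1)) (L (j - 1)) (K i) (L j)" if "j \<in> {1..n}" for j
    using grid_quad_lines[OF i that] by (rule quad_lines.quadrilateral)
  have diag: "normal a \<bullet> quadrilateral.diagonal_point (K (i - 1)) (L (j - 1)) (K i) (L j) = 0"
    if j: "j \<in> {1..n}" for j
  proof -
    interpret quad_lines "k (i - 1)" "l (j - 1)" "k i" "l j"
      using grid_quad_lines[OF i j] .
    show ?thesis
      using a[OF j] unfolding grid_quad_def diagonals_meet_eq on_line_point_of[OF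
          diagonal_point_nonzero] .
  qed
  have "bracket (L 0) (L 1) (L 2) \<noteq> 0"
    using n3 by (intro bracket_lines_nonzero) (auto simp: lines_distinct)
  then show thesis
    using strip_conic[of n "K (i - 1)" L "K i" "normal a"] quads diag n3 normal(1) that by auto
qed

text \<open>Two neighbouring rows share the line between them and \<open>l 0, l 1, l 2, l 3\<close>; here \<open>n \<ge> 3\<close> is
  essential.\<close>

lemma collinear_rows_imp_common_conic:
  assumes rows: "collinear_row_diagonals m n k l"
  shows "\<exists>D. all_vanish m n k l D"
proof -
  have "1 \<in> {1..m}"
    using m2 by simp
  from row_conic[OF rows this] obtain D where D: "transpose D = D" "D \<noteq> 0"
    "vanishes D (K 0)" "vanishes D (K 1)" "\<And>j. j \<le> n \<Longrightarrow> vanishes D (L j)"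
    by auto
  have step: "vanishes D (K (Suc i))" if "Suc i \<le> m" for i
    using that
  proof (induction i)
    case 0
    then show ?case
      using D by simp
  next
    case (Suc i)
    then have "Suc (Suc i) \<in> {1..m}"
      by simp
    from row_conic[OF rows this] obtain D' where D': "transpose D' = D'" "D' \<noteq> 0"
      "vanishes D' (K (Suc i))" "vanishes D' (K (Suc (Suc i)))" "\<And>j. j \<le> n \<Longrightarrow> vanishes D' (L j)"
      by auto
    have five: "five_lines (L 0) (L 1) (L 2) (L 3) (K (Suc i))"
      using n3 Suc.prems by (intro five_linesI) (auto simp: lines_distinct)
    show ?case
      by (rule five_lines.vanishing_transfer[OF five D'(1) _ _ _ _ D'(3) D(1) _ _ _ _ _ D'(2,4)])
        (use D D' Suc n3 in auto)
  qed
  have "vanishes D (K i)" if "i \<le> m" for i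
    using that step D(3) by (cases i) auto
  then show ?thesis
    using all_vanishI[OF D(1,2)] D(5) by blast
qed

end

theorem corollary4:
  fixes m n :: nat and k l :: "nat \<Rightarrow> proj_line"
  assumes "m \<ge> 2" and "n \<ge> 3"
    and "generic_lines (map k [0..<m + 1] @ map l [0..<n + 1])"
  shows "(common_tangent_conic m n k l \<longleftrightarrow>
      (\<exists>C. touching_instance m n k l C \<and> collinear_tangency_points m n k l C)) \<and>
    ((\<exists>C. touching_instance m n k l C \<and> collinear_tangency_points m n k l C) \<longleftrightarrow>
      (\<exists>C. touching_instance m n k l C)) \<and>
    ((\<exists>C. touching_instance m n k l C) \<longleftrightarrow> one_parameter_family m n k l) \<and>
    (one_parameter_family m n k l \<longleftrightarrow>
      collinear_column_diagonals m n k l \<and> collinear_row_diagonals m n k l) \<and>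
    (collinear_column_diagonals m n k l \<and> collinear_row_diagonals m n k l \<longleftrightarrow>
      collinear_row_diagonals m n k l)"
proof -
  interpret grid m n k l
    using assms by unfold_locales
  have "common_tangent_conic m n k l \<Longrightarrow>
      \<exists>C. touching_instance m n k l C \<and> collinear_tangency_points m n k l C"
    using common_conic_imp_collinear_instance common_tangent_conic_iff by blast
  moreover have "\<exists>C. touching_instance m n k l C \<Longrightarrow> common_tangent_conic m n k l"
    using solution_imp_common_conic touching_instance_iff common_tangent_conic_iff by blast
  moreover have "common_tangent_conic m n k l \<Longrightarrow>
      collinear_column_diagonals m n k l \<and> collinear_row_diagonals m n k l"
    using common_conic_imp_collinear_diagonals common_tangent_conic_iff by blast
  moreover have "collinear_row_diagonals m n k l \<Longrightarrow> common_tangent_conic m n k l"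
    using collinear_rows_imp_common_conic common_tangent_conic_iff by blast
  ultimately show ?thesis
    using one_parameter_family_iff by blast
qed

end
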